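(* Let $h$ be a real-valued function on $[0,+\infty)$ satisfying the following two conditions. (1) $h(x)\le1$ for $x>0$ and $m(h)<+\infty$. (2) For some $\alpha>0$ and $\delta>0$ the series $\sum_{k\in\mathbb{Z}}h(|k|^\alpha\delta)e^{ikt}$ is the Fourier series of some function $g_{\alpha,\delta}\in L_1$. Then $m(h)\ge0$, and $m(h)>0$ if $h(x_0)>0$ at some point $x_0>0$. Let $G_{\alpha,\delta}$ be the operator $G_{\alpha,\delta}(f)(x)=\frac1{2\pi}\int_{-\pi}^{\pi}f(x-t)g_{\alpha,\delta}(t)\,dt$, and let $p=1$ or $p=\infty$. Then: 1. If $\beta$ is an odd integer, then for all $r\ge\alpha m(h)+1$ $$E(\mathbf{W}^{r,\beta}_{p,1};G_{\alpha,\delta})_p=\frac{4}{\pi}\sum_{k=0}^{\infty}\frac{1-h((2k+1)^\alpha\delta)}{(2k+1)^{r+1}} .$$ 2. If $\beta$ is an even integer, then for all $r\ge\alpha m(h)+2$ $$E(\mathbf{W}^{r,\beta}_{p,1};G_{\alpha,\delta})_p=\frac{4}{\pi}\sum_{k=0}^{\infty}\frac{1-h((2k+1)^\alpha\delta)}{(2k+1)^{r+1}}(-1)^k .$$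
   Context: $L_p$, $1\le p\le\infty$, is the space of $2\pi$-periodic real-valued measurable functions with finite norm $\|f\|_p=(\int_{-\pi}^{\pi}|f(t)|^p\,dt)^{1/p}$ for $p<\infty$ and $\|f\|_\infty=\operatorname{ess\,sup}_{[-\pi,\pi]}|f|$. Fourier coefficients: $\widehat{\varphi}(k)=\frac1{2\pi}\int_{-\pi}^{\pi}\varphi(t)e^{-ikt}\,dt$; the Fourier series of $\varphi$ is $\sum_{k\in\mathbb{Z}}\widehat\varphi(k)e^{ikt}$. $H_p^1=\{\varphi\in L_p:\|\varphi\|_p\le1,\ \widehat\varphi(0)=0\}$. For $r>0$ and $\beta\in\mathbb{R}$ put $$\psi_{r,\beta}(t)=\sum_{k\ne0}\frac{e^{-i\beta\pi\operatorname{sign}(k)/2}}{|k|^r}e^{ikt}=\sum_{k=1}^\infty\frac{2\cos(kt-\beta\pi/2)}{k^r};$$ this function belongs to $L_1$ and the series is its Fourier series. $\mathbf{W}^{r,\beta}_{p,1}$ is the class of all functions $f(x)=\frac1{2\pi}\int_{-\pi}^{\pi}\varphi(x-t)\psi_{r,\beta}(t)\,dt$ with $\varphi\in H_p^1$. For an operator $G$, $E(\mathbf{W}^{r,\beta}_{p,1};G)_p=\sup\{\|f-G(f)\|_p: f\in\mathbf{W}^{r,\beta}_{p,1}\}$. For a function $h$ with $h(x)\le1$ for all $x>0$, $m(h)$ is the infimum of those $\gamma\in\mathbb{R}$ for which the function $(1-h(x))/x^{\gamma}$ is decreasing on $(0,+\infty)$; if no such $\gamma$ exists, $m(h):=+\infty$.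 "Decreasing" is in the weak sense (non-increasing). *)

theory Defs
  imports "HOL-Probability.Essential_Supremum"
begin

abbreviation period_measure :: "real measure" where
  "period_measure \<equiv> lebesgue_on {-pi..pi}"

text \<open>The exponent \<open>p\<close> is an extended real, meant for \<open>1 \<le> p \<le> \<infinity>\<close>.  The norm itself takes values
  in the extended reals, so that a non-integrable function has norm \<open>\<infinity>\<close>.\<close>

definition Lp_norm :: "ereal \<Rightarrow> (real \<Rightarrow> real) \<Rightarrow> ereal" where
  "Lp_norm p f =
     (if p = \<infinity> then esssup period_measure (\<lambda>t. ereal \<bar>f t\<bar>)
      else (let I = (\<integral>\<^sup>+t. ennreal (\<bar>f t\<bar> powr real_of_ereal p) \<partial>period_measure)
            in if I = \<infinity> then \<infinity> else ereal (enn2real I powr (1 / real_of_ereal p))))"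

definition Lp :: "ereal \<Rightarrow> (real \<Rightarrow> real) set" where
  "Lp p = {f. f \<in> borel_measurable lebesgue \<and> (\<forall>x. f (x + 2 * pi) = f x) \<and> Lp_norm p f < \<infinity>}"

definition fourier_coeff :: "(real \<Rightarrow> real) \<Rightarrow> int \<Rightarrow> complex" where
  "fourier_coeff f k =
     1 / (2 * pi) * (\<integral>t. complex_of_real (f t) * exp (- \<i> * of_int k * of_real t) \<partial>period_measure)"

definition conv :: "(real \<Rightarrow> real) \<Rightarrow> (real \<Rightarrow> real) \<Rightarrow> real \<Rightarrow> real" where
  "conv f g x = 1 / (2 * pi) * (\<integral>t. f (x - t) * g t \<partial>period_measure)"

definition H1 :: "ereal \<Rightarrow> (real \<Rightarrow> real) set" where
  "H1 p = {\<phi> \<in> Lp p. Lp_norm p \<phi> \<le> 1 \<and> fourier_coeff \<phi> 0 = 0}"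

text \<open>The index is shifted so that the sum starts at \<open>k = 1\<close>.  For \<open>r > 0\<close> the series converges (possibly
  only conditionally) at every \<open>t\<close> outside the null set \<open>2\<pi>\<int>\<close>, where its value is irrelevant.\<close>

definition psi :: "real \<Rightarrow> real \<Rightarrow> real \<Rightarrow> real" where
  "psi r \<beta> t = (\<Sum>k. 2 * cos (real (Suc k) * t - \<beta> * pi / 2) / real (Suc k) powr r)"

definition W_class :: "real \<Rightarrow> real \<Rightarrow> ereal \<Rightarrow> (real \<Rightarrow> real) set" where
  "W_class r \<beta> p = {conv \<phi> (psi r \<beta>) | \<phi>. \<phi> \<in> H1 p}"

definition approx_error ::
  "(real \<Rightarrow> real) set \<Rightarrow> ((real \<Rightarrow> real) \<Rightarrow> real \<Rightarrow> real) \<Rightarrow> ereal \<Rightarrow> ereal" where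
  "approx_error W G p = (SUP f\<in>W. Lp_norm p (\<lambda>x. f x - G f x))"

text \<open>In \<open>ereal\<close> the infimum of the empty set is \<open>\<infinity>\<close>.\<close>

definition m_index :: "(real \<Rightarrow> real) \<Rightarrow> ereal" where
  "m_index h = (INF \<gamma>\<in>{\<gamma>. antimono_on {0<..} (\<lambda>x. (1 - h x) / x powr \<gamma>)}. ereal \<gamma>)"

end

theory Submission
  imports Defs
begin

text \<open>Write \<open>f = \<phi> * \<psi>\<close>. All Fourier series involved have uniformly bounded partial sums and converge
  everywhere, so dominated convergence gives, pointwise, \<open>f - G f = \<phi> * K\<close>, where \<open>K\<close> has the coefficients
  \<open>a\<^sub>k = (1 - h (k\<^sup>\<alpha> \<delta>)) / k\<^sup>r\<close>. The infimum \<open>m(h)\<close> is attained, hence \<open>k a\<^sub>k\<close> (\<open>\<beta>\<close> odd) or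
  \<open>k\<^sup>2 a\<^sub>k\<close> (\<open>\<beta>\<close> even) is nonnegative and decreasing. For odd \<open>\<beta>\<close> the Fejer-Jackson inequality and
  summation by parts show that \<open>\<Sum> a\<^sub>k sin kt\<close> has the sign of \<open>sin t\<close>. For even \<open>\<beta>\<close> they show that
  \<open>\<Sum> a\<^sub>k cos kt\<close> decreases on \<open>[0, \<pi>]\<close>, so after subtraction of its value at \<open>\<pi>/2\<close> it has the sign
  of \<open>cos t\<close>. As \<open>\<phi>\<close> has mean zero, the error is at most \<open>(1 / 2\<pi>) \<integral> |K - c|\<close>, which can be evaluated because
  the sign of \<open>K - c\<close> is known. Testing against that sign function and against the difference
  of two opposite Fejer kernels shows that the bound is sharp in both norms.\<close>

subsection \<open>Trigonometric sums and summation by parts\<close>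

text \<open>When \<open>k a_k\<close> decreases, \<open>a_k\<close> is only O(1/k), so for odd
  \<beta> the kernel need not converge absolutely. What survives is a bound on the partial sums
  uniform in t, which is what dominated convergence asks for. It also replaces any interchange of
  integrals: a double integral with kernel K(x - t) is a limit of finite sums in which the variables
  separate.

  The threshold on r comes from writing \<open>k^\<rho> a_k\<close>, with \<rho> = 1 or 2, as a
  constant times (1 - h(y)) / y^m at y = k^\<alpha> \<delta>, times k^(\<alpha> m + \<rho> - r). The
  first factor decreases by the choice of m, the second if r \<ge> \<alpha> m + \<rho>. For the
  coefficients k^(-r) of \<psi> the same threshold works because m \<ge> 0.

  Only odd frequencies occur in the answer because the extremal sign is reversed by translation by
  \<pi>. This also explains the test functions: K - c has opposite signs (or vanishes) at t and t +
  \<pi>, so |K(t) - K(t + \<pi>)| = |K(t) - c| + |K(t + \<pi>) - c| and a difference of opposite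
  point masses loses nothing. The factor 4/\<pi> is 1/(2\<pi>), times the 2 in the kernel, times the
  4 in the moment 4/(2j + 1) of a square wave.\<close>

lemma two_sin_half_sum_cos:
  "2 * sin (t / 2) * (\<Sum>k<n. cos (real (Suc k) * t)) = sin ((real n + 1 / 2) * t) - sin (t / 2)"
proof (induction n)
  case (Suc n)
  have "sin ((real (Suc n) + 1 / 2) * t) - sin ((real n + 1 / 2) * t)
      = sin (real (Suc n) * t + t / 2) - sin (real (Suc n) * t - t / 2)"
    by (simp add: algebra_simps add_divide_distrib)
  also have "\<dots> = 2 * sin (t / 2) * cos (real (Suc n) * t)"
    unfolding sin_add sin_diff by simp
  finally show ?case using Suc by (simp add: algebra_simps)
qed simp

lemma two_sin_half_sum_sin:
  "2 * sin (t / 2) * (\<Sum>k<n. sin (real (Suc k) * t)) = cos (t / 2) - cos ((real n + 1 / 2) * t)"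
proof (induction n)
  case (Suc n)
  have "cos ((real n + 1 / 2) * t) - cos ((real (Suc n) + 1 / 2) * t)
      = cos (real (Suc n) * t - t / 2) - cos (real (Suc n) * t + t / 2)"
    by (simp add: algebra_simps add_divide_distrib)
  also have "\<dots> = 2 * sin (t / 2) * sin (real (Suc n) * t)"
    unfolding cos_add cos_diff by simp
  finally show ?case using Suc by (simp add: algebra_simps)
qed simp

section \<open>The Fejer kernel\<close>

definition fejer :: "nat \<Rightarrow> real \<Rightarrow> real" where
  "fejer n t = real n + 2 * (\<Sum>k<n. (real n - real (Suc k)) * cos (real (Suc k) * t))"

lemma fejer_Suc: "fejer (Suc n) t = fejer n t + 1 + 2 * (\<Sum>k<n. cos (real (Suc k) * t))"
  unfolding fejer_def by (simp add: algebra_simps sum.distrib sum_subtractf sum_distrib_left)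

text \<open>Each induction step adds a Dirichlet kernel, and the product formula makes the result
  telescope. As 1 - cos(nt) = 2 sin(nt/2)^2, \<open>fejer n\<close> is the square of sin(nt/2) /
  sin(t/2), which is n times the usual Fejer kernel.\<close>

lemma fejer_closed_form: "2 * (sin (t / 2))\<^sup>2 * fejer n t = 1 - cos (real n * t)"
proof (induction n)
  case (Suc n)
  have "2 * (sin (t / 2))\<^sup>2 * fejer (Suc n) t
      = 1 - cos (real n * t) + 2 * (sin (t / 2))\<^sup>2
        + 2 * sin (t / 2) * (2 * sin (t / 2) * (\<Sum>k<n. cos (real (Suc k) * t)))"
    unfolding fejer_Suc Suc.IH[symmetric] by (simp add: algebra_simps power2_eq_square)
  also have "\<dots> = 1 - cos (real n * t) + 2 * sin (t / 2) * sin ((real n + 1 / 2) * t)"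
    unfolding two_sin_half_sum_cos by (simp add: algebra_simps power2_eq_square)
  also have "2 * sin (t / 2) * sin ((real n + 1 / 2) * t)
      = cos ((real n + 1 / 2) * t - t / 2) - cos ((real n + 1 / 2) * t + t / 2)"
    unfolding cos_add cos_diff by simp
  also have "\<dots> = cos (real n * t) - cos (real (Suc n) * t)"
    by (simp add: algebra_simps add_divide_distrib)
  finally show ?case by simp
qed (simp add: fejer_def)

text \<open>The closed form decides the sign except where sin(t/2) = 0. There every cosine equals 1
  and the definition itself is a sum of nonnegative terms.\<close>

lemma fejer_nonneg: "0 \<le> fejer n t"
proof (cases "sin (t / 2) = 0")
  case True
  then have "cos t = 1" using cos_double_sin[of "t / 2"] by simp
  then obtain j :: int where "t = real_of_int j * 2 * pi" using cos_one_2pi_int by auto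
  then have "cos (real (Suc k) * t) = 1" for k
    using cos_int_2pin[of "int (Suc k) * j"] by (simp add: algebra_simps)
  then show ?thesis unfolding fejer_def by (auto intro!: add_nonneg_nonneg sum_nonneg simp del: of_nat_Suc)
next
  case False
  then have "0 < 2 * (sin (t / 2))\<^sup>2" by simp
  moreover have "0 \<le> 2 * (sin (t / 2))\<^sup>2 * fejer n t" using fejer_closed_form[of t n] by simp
  ultimately show ?thesis using zero_le_mult_iff[of "2 * (sin (t / 2))\<^sup>2" "fejer n t"] by linarith
qed

section \<open>Reduction to one period\<close>

lemma periodic_int_shift:
  fixes f :: "real \<Rightarrow> 'a"
  assumes "\<And>x. f (x + 2 * pi) = f x"
  shows "f (x + 2 * pi * real_of_int j) = f x"
proof -
  have nat: "f (y + 2 * pi * real n) = f y" for n y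
  proof (induction n)
    case (Suc n)
    then show ?case using assms[of "y + 2 * pi * real n"] by (simp add: algebra_simps)
  qed simp
  show ?thesis
  proof (cases "j \<ge> 0")
    case True
    then show ?thesis using nat[of x "nat j"] by simp
  next
    case False
    then show ?thesis using nat[of "x + 2 * pi * real_of_int j" "nat (- j)"] by simp
  qed
qed

lemma ex_int_shift_period:
  fixes t :: real
  obtains j :: int where "t + 2 * pi * real_of_int j \<in> {-pi..pi}"
proof
  let ?j = "- \<lfloor>(t + pi) / (2 * pi)\<rfloor>"
  have "of_int \<lfloor>(t + pi) / (2 * pi)\<rfloor> * (2 * pi) \<le> t + pi"
    by (subst pos_le_divide_eq[symmetric]) auto
  moreover have "t + pi < (of_int \<lfloor>(t + pi) / (2 * pi)\<rfloor> + 1) * (2 * pi)"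
    by (subst pos_divide_less_eq[symmetric]) (auto intro: floor_correct[THEN conjunct2])
  ultimately have "2 * pi * of_int \<lfloor>(t + pi) / (2 * pi)\<rfloor> \<le> t + pi"
    "t + pi < 2 * pi * of_int \<lfloor>(t + pi) / (2 * pi)\<rfloor> + 2 * pi"
    by (simp_all add: algebra_simps)
  then show "t + 2 * pi * real_of_int ?j \<in> {-pi..pi}" by simp
qed

lemma cos_harmonic_periodic: "cos (real k * (t + 2 * pi) - \<theta>) = cos (real k * t - \<theta>)"
proof -
  have "cos (real k * (t + 2 * pi) - \<theta>) = cos ((real k * t - \<theta>) + 2 * pi * real k)"
    by (simp add: algebra_simps)
  also have "\<dots> = cos (real k * t - \<theta>)"
    using periodic_int_shift[of cos "real k * t - \<theta>" "int k"] by simp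
  finally show ?thesis .
qed

lemma sin_harmonic_periodic: "sin (real k * (t + 2 * pi)) = sin (real k * t)"
  using cos_harmonic_periodic[of k t "pi / 2"] by (simp add: cos_diff)

section \<open>Partial sums of the sawtooth series\<close>

definition sin_sum :: "nat \<Rightarrow> real \<Rightarrow> real" where
  "sin_sum n t = (\<Sum>k<n. sin (real (Suc k) * t) / real (Suc k))"

lemma sin_sum_deriv: "(sin_sum n has_real_derivative (\<Sum>k<n. cos (real (Suc k) * t))) (at t)"
proof -
  have "((\<lambda>t. sin (real (Suc k) * t) / real (Suc k)) has_real_derivative cos (real (Suc k) * t)) (at t)" for k
    by (auto intro!: derivative_eq_intros simp del: of_nat_Suc)
  then show ?thesis unfolding sin_sum_def[abs_def] by (intro DERIV_sum)
qed

lemma sin_sum_periodic: "sin_sum n (t + 2 * pi) = sin_sum n t"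
  unfolding sin_sum_def using sin_harmonic_periodic by (simp del: of_nat_Suc)

text \<open>The \<open>n\<close>-th Fejer mean of the sawtooth series has derivative \<open>(fejer (n+1) / (n+1) - 1) / 2\<close>,
  which is at least \<open>-1/2\<close>, and differs from the partial sum by at most 1.\<close>

lemma sin_sum_bounded: "\<bar>sin_sum n t\<bar> \<le> pi + 1"
proof -
  define w where "w k = (1 - real (Suc k) / real (Suc n))" for k
  define F where "F t = (\<Sum>k<n. w k * (sin (real (Suc k) * t) / real (Suc k))) + t / 2" for t
  have deriv: "(F has_real_derivative fejer (Suc n) t / (2 * real (Suc n))) (at t)" for t
  proof -
    have "(F has_real_derivative (\<Sum>k<n. w k * cos (real (Suc k) * t)) + 1 / 2) (at t)"
    proof -
      have "((\<lambda>t. w k * (sin (real (Suc k) * t) / real (Suc k))) has_real_derivative w k * cos (real (Suc k) * t)) (at t)" for k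
        by (auto intro!: derivative_eq_intros simp del: of_nat_Suc)
      then show ?thesis unfolding F_def[abs_def]
        by (intro DERIV_add DERIV_sum) (auto intro!: derivative_eq_intros)
    qed
    moreover have "(\<Sum>k<n. w k * cos (real (Suc k) * t))
        = (\<Sum>k<n. (real (Suc n) - real (Suc k)) * cos (real (Suc k) * t)) / real (Suc n)"
      unfolding w_def sum_divide_distrib
      by (intro sum.cong refl) (simp add: field_simps del: of_nat_Suc)
    then have "(\<Sum>k<n. w k * cos (real (Suc k) * t)) + 1 / 2 = fejer (Suc n) t / (2 * real (Suc n))"
      unfolding fejer_def by (simp add: add_divide_distrib del: of_nat_Suc)
    ultimately show ?thesis by simp
  qed
  have mono: "F s \<le> F t" if "s \<le> t" for s t
    by (rule DERIV_nonneg_imp_nondecreasing[OF that], intro exI conjI, rule deriv)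
      (simp add: fejer_nonneg)
  have sin_npi0: "sin (real (Suc k) * pi) = 0" for k
    using sin_npi[of "Suc k"] by (simp only:)
  have Fpi: "F pi = pi / 2" "F (- pi) = - pi / 2"
    unfolding F_def using sin_npi0 by (simp_all del: of_nat_Suc)
  have diff: "\<bar>sin_sum n t - (F t - t / 2)\<bar> \<le> 1" for t
  proof -
    have "sin_sum n t - (F t - t / 2) = (\<Sum>k<n. sin (real (Suc k) * t) / real (Suc n))"
      unfolding sin_sum_def F_def w_def
      by (simp add: sum_subtractf[symmetric] algebra_simps del: of_nat_Suc)
        (auto intro!: sum.cong simp: field_simps simp del: of_nat_Suc)
    also have "\<bar>\<dots>\<bar> \<le> (\<Sum>k<n. 1 / real (Suc n))"
      by (rule sum_abs[THEN order_trans], rule sum_mono) (simp add: divide_right_mono)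
    also have "\<dots> \<le> 1" by (simp add: field_simps)
    finally show ?thesis .
  qed
  obtain j where j: "t + 2 * pi * real_of_int j \<in> {-pi..pi}" using ex_int_shift_period .
  define u where "u = t + 2 * pi * real_of_int j"
  have u: "- pi \<le> u" "u \<le> pi" using j unfolding u_def by auto
  have "sin_sum n t = sin_sum n u"
    unfolding u_def using periodic_int_shift[of "sin_sum n" t j] sin_sum_periodic by simp
  \<comment> \<open>Origin of the constant: \<open>F u\<close> and u/2 both lie in
    [-\<pi>/2, \<pi>/2], so the Fejer mean \<open>F u - u / 2\<close> is at most \<pi> in absolute
    value, and the partial sum is within 1 of it.\<close>
  moreover have "- pi / 2 \<le> F u" "F u \<le> pi / 2" using mono[OF u(1)] mono[OF u(2)] Fpi by auto
  moreover note diff[of u] u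
  ultimately show ?thesis by (simp add: abs_le_iff)
qed

text \<open>At an interior minimum the derivative, a Dirichlet sum, vanishes. This forces the last
  term sin((n+1)u) to be nonnegative, so the minimum of the new partial sum is at least the value of
  the previous one at the same point.\<close>

theorem fejer_jackson: "0 \<le> t \<Longrightarrow> t \<le> pi \<Longrightarrow> 0 \<le> sin_sum n t"
proof (induction n arbitrary: t)
  case (Suc n)
  have "continuous_on {0..pi} (sin_sum (Suc n))"
    using sin_sum_deriv by (intro continuous_at_imp_continuous_on) (blast intro: DERIV_isCont)
  then obtain u where u: "u \<in> {0..pi}" and min: "\<And>y. y \<in> {0..pi} \<Longrightarrow> sin_sum (Suc n) u \<le> sin_sum (Suc n) y"
    using continuous_attains_inf[of "{0..pi}" "sin_sum (Suc n)"] pi_ge_zero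
    by (metis atLeastAtMost_iff compact_Icc empty_iff order_refl)
  have "0 \<le> sin_sum (Suc n) u"
  proof (cases "u = 0 \<or> u = pi")
    case True
    have "sin (real (Suc k) * pi) = 0" for k using sin_npi[of "Suc k"] by (simp only:)
    then show ?thesis using True unfolding sin_sum_def by (auto simp del: of_nat_Suc)
  next
    case False
    then have u': "0 < u" "u < pi" using u by auto
    have "(\<Sum>k<Suc n. cos (real (Suc k) * u)) = 0"
    proof (rule DERIV_local_min[OF sin_sum_deriv])
      show "0 < min u (pi - u)" using u' by simp
      show "\<forall>y. \<bar>u - y\<bar> < min u (pi - u) \<longrightarrow> sin_sum (Suc n) u \<le> sin_sum (Suc n) y"
        using min by (auto simp: abs_less_iff)
    qed
    then have s: "sin ((real (Suc n) + 1 / 2) * u) = sin (u / 2)"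
      using two_sin_half_sum_cos[of u "Suc n"] by simp
    have pos: "0 < sin (u / 2)" "0 < cos (u / 2)"
      using u' by (auto intro!: sin_gt_zero cos_gt_zero_pi)
    \<comment> \<open>Equal sines leave only the two values cos(u/2) and -cos(u/2) for this cosine;
      as cos(u/2) > 0, the former is the larger.\<close>
    have "(cos ((real (Suc n) + 1 / 2) * u))\<^sup>2 = (cos (u / 2))\<^sup>2"
      using s by (simp add: cos_squared_eq)
    then have "cos ((real (Suc n) + 1 / 2) * u) \<le> cos (u / 2)"
      using pos by (smt (verit) power2_eq_iff)
    then have "sin (u / 2) * cos ((real (Suc n) + 1 / 2) * u) \<le> sin (u / 2) * cos (u / 2)"
      using pos by (intro mult_left_mono) auto
    moreover have "sin (real (Suc n) * u)
        = sin ((real (Suc n) + 1 / 2) * u) * cos (u / 2) - cos ((real (Suc n) + 1 / 2) * u) * sin (u / 2)"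
      unfolding sin_diff[symmetric] by (simp add: algebra_simps add_divide_distrib)
    ultimately have "0 \<le> sin (real (Suc n) * u)" using s by (simp add: mult.commute)
    moreover have "0 \<le> sin_sum n u" using Suc.IH u' by simp
    ultimately show ?thesis unfolding sin_sum_def by simp
  qed
  then show ?case using min[of t] Suc.prems by simp
qed (simp add: sin_sum_def)

section \<open>Summation by parts\<close>

lemma sum_by_parts:
  fixes d s :: "nat \<Rightarrow> real"
  shows "(\<Sum>k<n. d k * s k) = (\<Sum>k<n. (d k - d (Suc k)) * (\<Sum>i<Suc k. s i)) + d n * (\<Sum>i<n. s i)"
  by (induction n) (simp_all add: algebra_simps)

lemma abel_nonneg:
  fixes d s :: "nat \<Rightarrow> real"
  assumes "decseq d" "\<And>k. 0 \<le> d k" "\<And>n. 0 \<le> (\<Sum>i<n. s i)"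
  shows "0 \<le> (\<Sum>k<n. d k * s k)"
  proof -
  have "0 \<le> (d k - d (Suc k)) * (\<Sum>i<Suc k. s i)" for k
    using assms(3)[of "Suc k"] decseq_SucD[OF assms(1), of k] by (intro mult_nonneg_nonneg) auto
  moreover have "0 \<le> d n * (\<Sum>i<n. s i)" using assms(2,3) by (rule mult_nonneg_nonneg)
  ultimately show ?thesis unfolding sum_by_parts[of d s] by (intro add_nonneg_nonneg sum_nonneg)
qed

lemma abel_bounded:
  fixes d s :: "nat \<Rightarrow> real"
  assumes d: "decseq d" "\<And>k. 0 \<le> d k" and C: "\<And>n. \<bar>\<Sum>i<n. s i\<bar> \<le> C"
  shows "\<bar>\<Sum>k<n. d k * s k\<bar> \<le> C * d 0"
proof -
  have "\<bar>\<Sum>k<n. d k * s k\<bar> \<le> (\<Sum>k<n. \<bar>(d k - d (Suc k)) * (\<Sum>i<Suc k. s i)\<bar>) + \<bar>d n * (\<Sum>i<n. s i)\<bar>"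
    unfolding sum_by_parts[of d s] by (rule abs_triangle_ineq[THEN order_trans]) (intro add_right_mono sum_abs)
  also have "\<dots> \<le> (\<Sum>k<n. (d k - d (Suc k)) * C) + d n * C"
    using d(2) C decseq_SucD[OF d(1)] by (intro add_mono sum_mono)
      (auto simp: abs_mult simp del: sum.lessThan_Suc intro!: mult_mono)
  also have "\<dots> = C * d 0"
    unfolding sum_distrib_right[symmetric] sum_lessThan_telescope' by (simp add: algebra_simps)
  finally show ?thesis .
qed

text \<open>The two alternatives in \<open>lim\<close> are Dirichlet's and Abel's test: in either
  case the boundary term d n * S n converges. The first yields the sawtooth series itself, the
  second handles weights d whose limit may be positive.\<close>

lemma abel_convergent:
  fixes d s :: "nat \<Rightarrow> real"
  assumes d: "decseq d" "\<And>k. 0 \<le> d k" and C: "\<And>n. \<bar>\<Sum>i<n. s i\<bar> \<le> C"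
    and lim: "d \<longlonglongrightarrow> 0 \<or> summable s"
  shows "summable (\<lambda>k. d k * s k)"
proof -
  obtain l where l: "d \<longlonglongrightarrow> l" using decseq_convergent[of d 0] d by blast
  have "summable (\<lambda>k. (d k - d (Suc k)) * C)"
    by (intro summable_mult2 telescope_summable'[OF l])
  then have "summable (\<lambda>k. (d k - d (Suc k)) * (\<Sum>i<Suc k. s i))"
    by (rule summable_comparison_test[rotated])
      (use d(2) C decseq_SucD[OF d(1)] in
        \<open>auto simp: abs_mult simp del: sum.lessThan_Suc intro!: exI[of _ 0] mult_mono\<close>)
  moreover have "convergent (\<lambda>n. d n * (\<Sum>i<n. s i))"
    using lim
  proof
    assume "d \<longlonglongrightarrow> 0"
    then have "(\<lambda>n. d n * (\<Sum>i<n. s i)) \<longlonglongrightarrow> 0"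
      by (rule lim_null_mult_right_bounded[where B = C]) (simp add: C)
    then show ?thesis by (rule convergentI)
  next
    assume "summable s"
    then show ?thesis using l by (auto simp: summable_iff_convergent convergent_def intro: tendsto_mult)
  qed
  ultimately show ?thesis
    unfolding summable_iff_convergent sum_by_parts[of d s] by (intro convergent_add) auto
qed

subsection \<open>Integrals of periodic functions\<close>

lemma lebesgue_reflect_measurable: "(\<lambda>t::real. x - t) \<in> lebesgue \<rightarrow>\<^sub>M lebesgue"
  using lebesgue_affine_measurable[of "\<lambda>_. -1" x] by simp

lemma AE_lebesgue_neq: "AE t in lebesgue. t \<noteq> (a::real)"
proof -
  have "{a} \<in> null_sets lebesgue" by (simp add: null_sets_completionI null_sets_def)
  from AE_not_in[OF this] show ?thesis by simp
qed

lemma borel_measurable_mult_indicator_lebesgue: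
  fixes f :: "real \<Rightarrow> ennreal"
  assumes "f \<in> borel_measurable lebesgue" "S \<in> sets borel"
  shows "(\<lambda>u. f u * indicator S u) \<in> borel_measurable lebesgue"
  using assms by (intro borel_measurable_times_ennreal borel_measurable_indicator) auto

lemma nn_integral_period_translate:
  fixes f :: "real \<Rightarrow> ennreal"
  assumes f[measurable]: "f \<in> borel_measurable lebesgue" and per: "\<And>x. f (x + 2 * pi) = f x"
  shows "(\<integral>\<^sup>+u. f u * indicator {a..<a + 2 * pi} u \<partial>lebesgue)
    = (\<integral>\<^sup>+u. f u * indicator {b..<b + 2 * pi} u \<partial>lebesgue)"
proof -
  define I where "I S = (\<integral>\<^sup>+u. f u * indicator S u \<partial>lebesgue)" for S
  have shift: "I {c + 2 * pi * real_of_int j..<d + 2 * pi * real_of_int j} = I {c..<d}" for c d j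
  proof -
    have "I {c + 2 * pi * real_of_int j..<d + 2 * pi * real_of_int j}
        = (\<integral>\<^sup>+u. f (2 * pi * real_of_int j + u)
            * indicator {c + 2 * pi * real_of_int j..<d + 2 * pi * real_of_int j} (2 * pi * real_of_int j + u) \<partial>lebesgue)"
      unfolding I_def
      by (subst nn_integral_real_affine_lebesgue[where c = 1 and t = "2 * pi * real_of_int j"])
        (auto intro!: borel_measurable_mult_indicator_lebesgue f)
    also have "\<dots> = I {c..<d}"
      unfolding I_def using periodic_int_shift[of f _ j] per
      by (intro nn_integral_cong) (auto simp: indicator_def add.commute)
    finally show ?thesis .
  qed
  have split: "I {c..<d} + I {d..<e} = I {c..<e}" if "c \<le> d" "d \<le> e" for c d e
  proof -
    have "I {c..<d} + I {d..<e}
        = (\<integral>\<^sup>+u. f u * indicator {c..<d} u + f u * indicator {d..<e} u \<partial>lebesgue)"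
      unfolding I_def by (rule nn_integral_add[symmetric]; intro borel_measurable_mult_indicator_lebesgue f) auto
    also have "\<dots> = I {c..<e}"
      unfolding I_def using that by (intro nn_integral_cong) (auto simp: indicator_def)
    finally show ?thesis .
  qed
  \<comment> \<open>Once the j whole periods are removed from b - a, the window starting at a + c
    overshoots a + 2\<pi> by exactly the translate of the piece [a, a + c) that it omits.\<close>
  define j where "j = \<lfloor>(b - a) / (2 * pi)\<rfloor>"
  define c where "c = b - a - 2 * pi * real_of_int j"
  have "real_of_int j * (2 * pi) \<le> b - a"
    unfolding j_def by (subst pos_le_divide_eq[symmetric]) auto
  moreover have "b - a < (real_of_int j + 1) * (2 * pi)"
    unfolding j_def by (subst pos_divide_less_eq[symmetric]) (auto intro: floor_correct[THEN conjunct2])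
  ultimately have c: "0 \<le> c" "c \<le> 2 * pi" unfolding c_def by (simp_all add: algebra_simps)
  have "I {b..<b + 2 * pi} = I {a + c..<a + c + 2 * pi}"
    using shift[of "a + c" j "a + c + 2 * pi"] unfolding c_def by (simp add: algebra_simps)
  also have "\<dots> = I {a + c..<a + 2 * pi} + I {a + 2 * pi..<a + c + 2 * pi}"
    using c by (subst split) auto
  also have "I {a + 2 * pi..<a + c + 2 * pi} = I {a..<a + c}"
    using shift[of a 1 "a + c"] by simp
  also have "I {a + c..<a + 2 * pi} + I {a..<a + c} = I {a..<a + 2 * pi}"
    using split[of a "a + c" "a + 2 * pi"] c by (simp add: add.commute)
  finally show ?thesis unfolding I_def by simp
qed

text \<open>The reflection carries [-\<pi>, \<pi>] to [x - \<pi>, x + \<pi>]. Closed and half-open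
  windows differ in one point, so translation invariance applies.\<close>

lemma nn_integral_period_reflect:
  fixes f :: "real \<Rightarrow> ennreal"
  assumes f[measurable]: "f \<in> borel_measurable lebesgue" and per: "\<And>x. f (x + 2 * pi) = f x"
  shows "(\<integral>\<^sup>+t. f (x - t) \<partial>period_measure) = (\<integral>\<^sup>+t. f t \<partial>period_measure)"
proof -
  have half_open: "(\<integral>\<^sup>+u. f u * indicator {a..a + 2 * pi} u \<partial>lebesgue)
      = (\<integral>\<^sup>+u. f u * indicator {a..<a + 2 * pi} u \<partial>lebesgue)" for a
  proof (rule nn_integral_cong_AE)
    show "AE u in lebesgue. f u * indicator {a..a + 2 * pi} u = f u * indicator {a..<a + 2 * pi} u"
      using AE_lebesgue_neq[of "a + 2 * pi"] by eventually_elim (auto simp: indicator_def)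
  qed
  have "(\<integral>\<^sup>+t. f (x - t) \<partial>period_measure) = (\<integral>\<^sup>+t. f (x - t) * indicator {-pi..pi} t \<partial>lebesgue)"
    by (simp add: nn_integral_restrict_space)
  also have "\<dots> = (\<integral>\<^sup>+t. f (x + (-1) * t) * indicator {x - pi..x - pi + 2 * pi} (x + (-1) * t) \<partial>lebesgue)"
    by (intro nn_integral_cong) (auto simp: indicator_def)
  also have "\<dots> = (\<integral>\<^sup>+t. f t * indicator {x - pi..x - pi + 2 * pi} t \<partial>lebesgue)"
    by (subst (2) nn_integral_real_affine_lebesgue[where c = "-1" and t = x])
      (auto intro!: borel_measurable_mult_indicator_lebesgue f)
  also have "\<dots> = (\<integral>\<^sup>+u. f u * indicator {-pi..-pi + 2 * pi} u \<partial>lebesgue)"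
    unfolding half_open using nn_integral_period_translate[OF f per] .
  also have "\<dots> = (\<integral>\<^sup>+t. f t \<partial>period_measure)"
    by (simp add: nn_integral_restrict_space)
  finally show ?thesis .
qed

text \<open>The common setting for p = 1 and p = \<infinity>: the members of \<open>H1 p\<close> and
  the test functions of both cases belong to it.\<close>

definition periodic_L1 :: "(real \<Rightarrow> real) \<Rightarrow> bool" where
  "periodic_L1 f \<longleftrightarrow> f \<in> borel_measurable lebesgue \<and> (\<forall>x. f (x + 2 * pi) = f x) \<and> integrable period_measure f"

lemma periodic_L1D:
  assumes "periodic_L1 f"
  shows "f \<in> borel_measurable lebesgue" "f (x + 2 * pi) = f x" "integrable period_measure f"
  using assms unfolding periodic_L1_def by auto

lemma period_measure_measurable: "f \<in> borel_measurable lebesgue \<Longrightarrow> f \<in> borel_measurable period_measure"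
  by (rule measurable_restrict_space1)

lemma emeasure_period_measure: "emeasure period_measure (space period_measure) = ennreal (2 * pi)"
  by (simp add: emeasure_restrict_space space_restrict_space)

lemma finite_period_measure: "finite_measure period_measure"
  by (rule finite_measureI, subst emeasure_period_measure) simp

lemma measure_period_measure: "measure period_measure (space period_measure) = 2 * pi"
  unfolding measure_def emeasure_period_measure by simp

lemma integrable_period_bounded:
  fixes f :: "real \<Rightarrow> real"
  assumes "f \<in> borel_measurable lebesgue" "\<And>t. \<bar>f t\<bar> \<le> C"
  shows "integrable period_measure f"
  using finite_measure.integrable_const_bound[OF finite_period_measure, of f C] assms
  by (simp add: period_measure_measurable)

lemma periodic_L1I:
  fixes f :: "real \<Rightarrow> real"
  assumes "f \<in> borel_measurable lebesgue" "\<And>t. f (t + 2 * pi) = f t" "\<And>t. \<bar>f t\<bar> \<le> C"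
  shows "periodic_L1 f"
  unfolding periodic_L1_def using assms integrable_period_bounded by blast

lemma integral_period_const: "(\<integral>t. (c::real) \<partial>period_measure) = 2 * pi * c"
  by (subst lebesgue_integral_const, subst measure_period_measure) simp

lemma integrable_mult_bounded:
  fixes f w :: "real \<Rightarrow> real"
  assumes "integrable period_measure f" "w \<in> borel_measurable lebesgue" "\<And>t. \<bar>w t\<bar> \<le> C"
  shows "integrable period_measure (\<lambda>t. f t * w t)"
proof (rule Bochner_Integration.integrable_bound)
  show "integrable period_measure (\<lambda>t. C * f t)" using assms(1) by simp
  show "(\<lambda>t. f t * w t) \<in> borel_measurable period_measure"
    using assms period_measure_measurable by (intro borel_measurable_times) auto
  have "\<bar>w t\<bar> \<le> \<bar>C\<bar>" for t using assms(3)[of t] by linarith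
  then show "AE t in period_measure. norm (f t * w t) \<le> norm (C * f t)"
    by (auto simp: abs_mult mult.commute[of "\<bar>C\<bar>"] intro!: always_eventually mult_left_mono)
qed

lemma periodic_L1_mult_bounded:
  assumes f: "periodic_L1 f" and w: "w \<in> borel_measurable lebesgue" "\<And>t. w (t + 2 * pi) = w t" "\<And>t. \<bar>w t\<bar> \<le> C"
  shows "periodic_L1 (\<lambda>t. f t * w t)"
  unfolding periodic_L1_def
  using integrable_mult_bounded[OF periodic_L1D(3)[OF f] w(1,3)] periodic_L1D(1,2)[OF f] w by auto

text \<open>The nonnegative version is applied to |f| for integrability, and to the positive and
  negative parts for the value.\<close>

lemma periodic_L1_reflect:
  assumes "periodic_L1 f"
  shows "integrable period_measure (\<lambda>t. f (x - t))"
    and "(\<integral>t. f (x - t) \<partial>period_measure) = (\<integral>t. f t \<partial>period_measure)"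
proof -
  note f = periodic_L1D[OF assms]
  note [measurable] = f(1)
  have nn: "(\<integral>\<^sup>+t. ennreal (g (f (x - t))) \<partial>period_measure) = (\<integral>\<^sup>+t. ennreal (g (f t)) \<partial>period_measure)"
    if [measurable]: "g \<in> borel_measurable borel" for g :: "real \<Rightarrow> real"
    by (rule nn_integral_period_reflect) (auto simp: f)
  have [measurable]: "(\<lambda>t. f (x - t)) \<in> borel_measurable period_measure"
    by (intro period_measure_measurable measurable_compose[OF lebesgue_reflect_measurable f(1)])
  show int: "integrable period_measure (\<lambda>t. f (x - t))"
    using f(3) nn[of "\<lambda>x. norm x"] unfolding integrable_iff_bounded by simp
  show "(\<integral>t. f (x - t) \<partial>period_measure) = (\<integral>t. f t \<partial>period_measure)"
    unfolding real_lebesgue_integral_def[OF int] real_lebesgue_integral_def[OF f(3)]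
    using nn[of "\<lambda>x. x"] nn[of "\<lambda>x. - x"] by simp
qed

text \<open>A translation is the composition of two reflections.\<close>

lemma periodic_L1_translate:
  assumes "periodic_L1 f"
  shows "(\<integral>t. f (t + x) \<partial>period_measure) = (\<integral>t. f t \<partial>period_measure)"
proof -
  have per: "periodic_L1 (\<lambda>t. f (0 - t))"
    unfolding periodic_L1_def
  proof (intro conjI allI)
    show "(\<lambda>t. f (0 - t)) \<in> borel_measurable lebesgue"
      by (rule measurable_compose[OF lebesgue_reflect_measurable periodic_L1D(1)[OF assms]])
    show "integrable period_measure (\<lambda>t. f (0 - t))" by (rule periodic_L1_reflect(1)[OF assms])
    show "f (0 - (t + 2 * pi)) = f (0 - t)" for t
      using periodic_L1D(2)[OF assms, of "- t - 2 * pi"] by simp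
  qed
  show ?thesis
    using periodic_L1_reflect(2)[OF per, of "- x"] periodic_L1_reflect(2)[OF assms, of 0] by (simp add: add.commute)
qed

lemma integral_antiperiodic:
  assumes f: "periodic_L1 f" and anti: "\<And>t. f (t + pi) = - f t"
  shows "(\<integral>t. f t \<partial>period_measure) = 0"
  using periodic_L1_translate[OF f, of pi] unfolding anti by simp

text \<open>Substituting x - t for t moves x from the merely integrable f into the bounded factor w,
  which can then be expanded in harmonics of x.\<close>

lemma conv_flip:
  assumes "periodic_L1 f" and w: "w \<in> borel_measurable lebesgue" "\<And>t. w (t + 2 * pi) = w t" "\<And>t. \<bar>w t\<bar> \<le> C"
  shows "conv f w x = 1 / (2 * pi) * (\<integral>t. f t * w (x - t) \<partial>period_measure)"
proof -
  have "w (x - (t + 2 * pi)) = w (x - t)" for t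
    using w(2)[of "x - (t + 2 * pi)"] by (simp add: algebra_simps)
  then have "periodic_L1 (\<lambda>t. f t * w (x - t))"
    using w measurable_compose[OF lebesgue_reflect_measurable w(1)]
    by (intro periodic_L1_mult_bounded[OF assms(1), of _ C]) auto
  from periodic_L1_reflect(2)[OF this, of x] show ?thesis unfolding conv_def by simp
qed

subsection \<open>Kernels with bounded partial sums\<close>

definition trig_sum :: "(nat \<Rightarrow> real) \<Rightarrow> real \<Rightarrow> nat \<Rightarrow> real \<Rightarrow> real" where
  "trig_sum a \<theta> n t = (\<Sum>k<n. 2 * a k * cos (real (Suc k) * t - \<theta>))"

lemma integral_sum_lincomb:
  fixes f\<^sub>1 f\<^sub>2 :: "nat \<Rightarrow> 'a \<Rightarrow> real"
  assumes "\<And>k. integrable M (f\<^sub>1 k)" "\<And>k. integrable M (f\<^sub>2 k)"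
  shows "(\<integral>x. (\<Sum>k<n. u k * f\<^sub>1 k x + v k * f\<^sub>2 k x) \<partial>M)
    = (\<Sum>k<n. u k * (\<integral>x. f\<^sub>1 k x \<partial>M) + v k * (\<integral>x. f\<^sub>2 k x \<partial>M))"
  using assms by (subst Bochner_Integration.integral_sum) auto

section \<open>Moments against cosines and sines\<close>

definition cos_moment :: "(real \<Rightarrow> real) \<Rightarrow> nat \<Rightarrow> real" where
  "cos_moment f k = (\<integral>t. f t * cos (real k * t) \<partial>period_measure)"

definition sin_moment :: "(real \<Rightarrow> real) \<Rightarrow> nat \<Rightarrow> real" where
  "sin_moment f k = (\<integral>t. f t * sin (real k * t) \<partial>period_measure)"

lemma borel_measurable_harmonic [measurable]:
  "(\<lambda>t. cos (a * t - b)) \<in> borel_measurable borel" "(\<lambda>t. sin (a * t - b)) \<in> borel_measurable borel"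
  "(\<lambda>t. cos (a * t)) \<in> borel_measurable borel" "(\<lambda>t. sin (a * t)) \<in> borel_measurable borel"
  for a b :: real
  by (intro borel_measurable_continuous_onI continuous_intros)+

lemma borel_imp_lebesgue_measurable: "f \<in> borel_measurable borel \<Longrightarrow> f \<in> borel_measurable lebesgue"
  for f :: "real \<Rightarrow> real"
  by (rule measurable_completion) simp

lemma integrable_mult_harmonic:
  assumes "integrable period_measure f"
  shows "integrable period_measure (\<lambda>t. f t * cos (a * t - b))"
    "integrable period_measure (\<lambda>t. f t * sin (a * t - b))"
    "integrable period_measure (\<lambda>t. f t * cos (a * t))"
    "integrable period_measure (\<lambda>t. f t * sin (a * t))"
  by (intro integrable_mult_bounded[where C = 1] borel_imp_lebesgue_measurable assms; simp)+

text \<open>The addition formula separates x from t; this makes the convolution of f with a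
  trigonometric sum a finite sum in x.\<close>

lemma integral_mult_cos_reflect:
  assumes f: "integrable period_measure f"
  shows "integrable period_measure (\<lambda>t. f t * cos (real k * (x - t) - \<theta>))" (is ?int)
    and "(\<integral>t. f t * cos (real k * (x - t) - \<theta>) \<partial>period_measure)
      = cos (real k * x - \<theta>) * cos_moment f k + sin (real k * x - \<theta>) * sin_moment f k" (is ?eq)
proof -
  have "f t * cos (real k * (x - t) - \<theta>)
      = cos (real k * x - \<theta>) * (f t * cos (real k * t)) + sin (real k * x - \<theta>) * (f t * sin (real k * t))" for t
  proof -
    have "cos (real k * (x - t) - \<theta>)
        = cos (real k * x - \<theta>) * cos (real k * t) + sin (real k * x - \<theta>) * sin (real k * t)"
      unfolding cos_diff[symmetric] by (simp add: algebra_simps)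
    then show ?thesis by (simp only: ring_distribs mult_ac)
  qed
  then show ?int ?eq
    unfolding cos_moment_def sin_moment_def using integrable_mult_harmonic(3,4)[OF f] by simp_all
qed

lemma integral_mult_trig_sum_reflect:
  assumes f: "integrable period_measure f"
  shows "(\<integral>t. f t * trig_sum a \<theta> n (x - t) \<partial>period_measure)
    = (\<Sum>k<n. 2 * a k * (cos (real (Suc k) * x - \<theta>) * cos_moment f (Suc k)
        + sin (real (Suc k) * x - \<theta>) * sin_moment f (Suc k)))"
proof -
  have "(\<integral>t. f t * trig_sum a \<theta> n (x - t) \<partial>period_measure)
      = (\<integral>t. (\<Sum>k<n. 2 * a k * (f t * cos (real (Suc k) * (x - t) - \<theta>))) \<partial>period_measure)"
    unfolding trig_sum_def by (simp add: sum_distrib_left algebra_simps del: of_nat_Suc)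
  also have "\<dots> = (\<Sum>k<n. 2 * a k * (\<integral>t. f t * cos (real (Suc k) * (x - t) - \<theta>) \<partial>period_measure))"
    using integral_mult_cos_reflect(1)[OF f]
    by (subst Bochner_Integration.integral_sum) (auto simp del: of_nat_Suc)
  finally show ?thesis unfolding integral_mult_cos_reflect(2)[OF f] .
qed

text \<open>Serves both \<psi> and the error kernel. The bound must be uniform in t and n, since it
  provides the integrable majorants; convergence is asked at every t, so K is a definite function
  and not a class modulo null sets.\<close>

locale bounded_series =
  fixes a :: "nat \<Rightarrow> real" and \<theta> C :: real and K :: "real \<Rightarrow> real"
  assumes trig_sum_bounded: "\<bar>trig_sum a \<theta> n t\<bar> \<le> C"
    and trig_sum_tendsto: "(\<lambda>n. trig_sum a \<theta> n t) \<longlonglongrightarrow> K t"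
begin

lemma trig_sum_borel: "trig_sum a \<theta> n \<in> borel_measurable borel"
  unfolding trig_sum_def[abs_def] by (intro borel_measurable_sum borel_measurable_times borel_measurable_harmonic) simp_all

lemma K_borel: "K \<in> borel_measurable borel"
  by (rule borel_measurable_LIMSEQ_real[OF trig_sum_tendsto trig_sum_borel])

lemma K_bounded: "\<bar>K t\<bar> \<le> C"
  by (rule LIMSEQ_le_const2[OF tendsto_rabs[OF trig_sum_tendsto]]) (auto intro: trig_sum_bounded)

lemma K_periodic: "K (t + 2 * pi) = K t"
proof -
  have "trig_sum a \<theta> n (t + 2 * pi) = trig_sum a \<theta> n t" for n
    unfolding trig_sum_def cos_harmonic_periodic ..
  then show ?thesis using LIMSEQ_unique[OF trig_sum_tendsto[of "t + 2 * pi"]] trig_sum_tendsto[of t] by simp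
qed

text \<open>The inner map \<tau> lets one statement cover integration over either variable of K(x -
  t) as well as the plain integral of f K.\<close>

lemma integral_mult_K:
  assumes f: "integrable period_measure f" and \<tau>: "\<tau> \<in> borel_measurable borel"
  shows "(\<lambda>n. \<integral>t. f t * trig_sum a \<theta> n (\<tau> t) \<partial>period_measure) \<longlonglongrightarrow> (\<integral>t. f t * K (\<tau> t) \<partial>period_measure)"
    and "\<bar>\<integral>t. f t * trig_sum a \<theta> n (\<tau> t) \<partial>period_measure\<bar> \<le> C * (\<integral>t. \<bar>f t\<bar> \<partial>period_measure)"
    and "integrable period_measure (\<lambda>t. f t * K (\<tau> t))"
    and "integrable period_measure (\<lambda>t. f t * trig_sum a \<theta> n (\<tau> t))"
proof -
  have meas: "(\<lambda>t. K (\<tau> t)) \<in> borel_measurable lebesgue" "(\<lambda>t. trig_sum a \<theta> n (\<tau> t)) \<in> borel_measurable lebesgue" for n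
    using measurable_compose[OF \<tau> K_borel] measurable_compose[OF \<tau> trig_sum_borel]
    by (auto intro: borel_imp_lebesgue_measurable)
  show int: "integrable period_measure (\<lambda>t. f t * K (\<tau> t))"
    "integrable period_measure (\<lambda>t. f t * trig_sum a \<theta> n (\<tau> t))" for n
    using integrable_mult_bounded[OF f meas(1) K_bounded]
      integrable_mult_bounded[OF f meas(2) trig_sum_bounded] .
  have bound: "norm (f t * trig_sum a \<theta> n (\<tau> t)) \<le> C * \<bar>f t\<bar>" for t n
    using mult_right_mono[OF trig_sum_bounded[of n "\<tau> t"], of "\<bar>f t\<bar>"] by (simp add: abs_mult mult.commute)
  show "(\<lambda>n. \<integral>t. f t * trig_sum a \<theta> n (\<tau> t) \<partial>period_measure) \<longlonglongrightarrow> (\<integral>t. f t * K (\<tau> t) \<partial>period_measure)"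
  proof (rule integral_dominated_convergence)
    show "integrable period_measure (\<lambda>t. C * \<bar>f t\<bar>)" using f by simp
    show "AE t in period_measure. (\<lambda>n. f t * trig_sum a \<theta> n (\<tau> t)) \<longlonglongrightarrow> f t * K (\<tau> t)"
      by (intro always_eventually allI tendsto_mult tendsto_const trig_sum_tendsto)
    show "\<And>n. AE t in period_measure. norm (f t * trig_sum a \<theta> n (\<tau> t)) \<le> C * \<bar>f t\<bar>"
      using bound by simp
  qed (use int in auto)
  have "\<bar>\<integral>t. f t * trig_sum a \<theta> n (\<tau> t) \<partial>period_measure\<bar> \<le> (\<integral>t. norm (f t * trig_sum a \<theta> n (\<tau> t)) \<partial>period_measure)"
    using integral_norm_bound[of period_measure "\<lambda>t. f t * trig_sum a \<theta> n (\<tau> t)"] by simp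
  also have "\<dots> \<le> (\<integral>t. C * \<bar>f t\<bar> \<partial>period_measure)"
    by (rule integral_mono) (use int f bound in auto)
  finally show "\<bar>\<integral>t. f t * trig_sum a \<theta> n (\<tau> t) \<partial>period_measure\<bar> \<le> C * (\<integral>t. \<bar>f t\<bar> \<partial>period_measure)"
    by simp
qed

lemma integral_mult_K_reflect_tendsto:
  assumes f: "integrable period_measure f"
  shows "(\<lambda>n. \<Sum>k<n. 2 * a k * (cos (real (Suc k) * x - \<theta>) * cos_moment f (Suc k)
        + sin (real (Suc k) * x - \<theta>) * sin_moment f (Suc k)))
    \<longlonglongrightarrow> (\<integral>t. f t * K (x - t) \<partial>period_measure)"
  using integral_mult_K(1)[OF f, of "\<lambda>t. x - t"] unfolding integral_mult_trig_sum_reflect[OF f] by simp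

lemma trig_conv_bounded:
  assumes f: "integrable period_measure f"
  shows "\<bar>\<Sum>k<n. 2 * a k * (cos (real (Suc k) * x - \<theta>) * cos_moment f (Suc k)
        + sin (real (Suc k) * x - \<theta>) * sin_moment f (Suc k))\<bar> \<le> C * (\<integral>t. \<bar>f t\<bar> \<partial>period_measure)"
  using integral_mult_K(2)[OF f, of "\<lambda>t. x - t" n] unfolding integral_mult_trig_sum_reflect[OF f] by simp

lemma trig_conv_borel:
  "(\<lambda>x. \<Sum>k<n. 2 * a k * (cos (real (Suc k) * x - \<theta>) * cos_moment f (Suc k)
        + sin (real (Suc k) * x - \<theta>) * sin_moment f (Suc k))) \<in> borel_measurable borel"
  by (intro borel_measurable_sum borel_measurable_times borel_measurable_add borel_measurable_harmonic) simp_all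

lemma K_conv_borel:
  assumes f: "integrable period_measure f"
  shows "(\<lambda>x. \<integral>t. f t * K (x - t) \<partial>period_measure) \<in> borel_measurable borel"
  by (rule borel_measurable_LIMSEQ_real[OF integral_mult_K_reflect_tendsto[OF f] trig_conv_borel])

lemma K_conv_bounded:
  assumes f: "integrable period_measure f"
  shows "\<bar>\<integral>t. f t * K (x - t) \<partial>period_measure\<bar> \<le> C * (\<integral>t. \<bar>f t\<bar> \<partial>period_measure)"
  by (rule LIMSEQ_le_const2[OF tendsto_rabs[OF integral_mult_K_reflect_tendsto[OF f]]])
    (intro exI allI impI, rule trig_conv_bounded[OF f])

lemma conv_K: "periodic_L1 f \<Longrightarrow> conv f K x = 1 / (2 * pi) * (\<integral>t. f t * K (x - t) \<partial>period_measure)"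
  by (rule conv_flip[OF _ borel_imp_lebesgue_measurable[OF K_borel] K_periodic K_bounded])

lemma conv_K_borel: "periodic_L1 f \<Longrightarrow> conv f K \<in> borel_measurable borel"
  using K_conv_borel[of f] periodic_L1D(3)[of f] conv_K[of f] by (simp add: fun_eq_iff cong: measurable_cong)

text \<open>Both sides are limits of the same finite sums, so no theorem of Fubini type is needed.\<close>

lemma
  assumes f: "integrable period_measure f" and g: "integrable period_measure g"
  shows bilinear_tendsto: "(\<lambda>n. \<Sum>k<n. 2 * a k *
        ((\<integral>x. g x * cos (real (Suc k) * x - \<theta>) \<partial>period_measure) * cos_moment f (Suc k)
        + (\<integral>x. g x * sin (real (Suc k) * x - \<theta>) \<partial>period_measure) * sin_moment f (Suc k)))
      \<longlonglongrightarrow> (\<integral>x. g x * (\<integral>t. f t * K (x - t) \<partial>period_measure) \<partial>period_measure)" (is "?S \<longlonglongrightarrow> ?L")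
    and bilinear_swap: "(\<integral>x. g x * (\<integral>t. f t * K (x - t) \<partial>period_measure) \<partial>period_measure)
      = (\<integral>t. f t * (\<integral>x. g x * K (x - t) \<partial>period_measure) \<partial>period_measure)"
proof -
  let ?c = "\<lambda>k. \<integral>x. g x * cos (real k * x - \<theta>) \<partial>period_measure"
  let ?s = "\<lambda>k. \<integral>x. g x * sin (real k * x - \<theta>) \<partial>period_measure"
  define F where "F n x = (\<Sum>k<n. 2 * a k * (cos (real (Suc k) * x - \<theta>) * cos_moment f (Suc k)
        + sin (real (Suc k) * x - \<theta>) * sin_moment f (Suc k)))" for n x
  define G where "G n t = (\<integral>x. g x * trig_sum a \<theta> n (x - t) \<partial>period_measure)" for n t
  have intF: "(\<integral>x. g x * F n x \<partial>period_measure) = ?S n" for n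
  proof -
    have *: "g x * F n x = (\<Sum>k<n. 2 * a k * cos_moment f (Suc k) * (g x * cos (real (Suc k) * x - \<theta>))
        + 2 * a k * sin_moment f (Suc k) * (g x * sin (real (Suc k) * x - \<theta>)))" for x
      unfolding F_def sum_distrib_left by (intro sum.cong refl) (simp add: algebra_simps del: of_nat_Suc)
    show ?thesis
      unfolding * integral_sum_lincomb[OF integrable_mult_harmonic(1,2)[OF g]]
      by (intro sum.cong refl) (simp only: ring_distribs mult_ac)
  qed
  have "(\<lambda>n. \<integral>x. g x * F n x \<partial>period_measure) \<longlonglongrightarrow> ?L"
  proof (rule integral_dominated_convergence)
    let ?B = "C * (\<integral>t. \<bar>f t\<bar> \<partial>period_measure)"
    show "integrable period_measure (\<lambda>x. ?B * \<bar>g x\<bar>)" using g by simp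
    show "AE x in period_measure. (\<lambda>n. g x * F n x) \<longlonglongrightarrow> g x * (\<integral>t. f t * K (x - t) \<partial>period_measure)"
      unfolding F_def by (intro always_eventually allI tendsto_mult tendsto_const integral_mult_K_reflect_tendsto f)
    have "\<bar>F n x\<bar> * \<bar>g x\<bar> \<le> ?B * \<bar>g x\<bar>" for n x
      unfolding F_def by (intro mult_right_mono trig_conv_bounded f) simp
    then show "\<And>n. AE x in period_measure. norm (g x * F n x) \<le> ?B * \<bar>g x\<bar>"
      by (simp add: abs_mult mult.commute)
    show "(\<lambda>x. g x * (\<integral>t. f t * K (x - t) \<partial>period_measure)) \<in> borel_measurable period_measure"
      using g
      by (intro borel_measurable_times period_measure_measurable[OF borel_imp_lebesgue_measurable[OF K_conv_borel]] f) auto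
    show "\<And>n. (\<lambda>x. g x * F n x) \<in> borel_measurable period_measure"
      unfolding F_def using g
      by (intro borel_measurable_times period_measure_measurable[OF borel_imp_lebesgue_measurable[OF trig_conv_borel]]) auto
  qed
  then show L: "?S \<longlonglongrightarrow> ?L" unfolding intF .
  have G: "G n t = (\<Sum>k<n. 2 * a k * (cos (real (Suc k) * t) * ?c (Suc k) + sin (real (Suc k) * t) * ?s (Suc k)))" for n t
  proof -
    have *: "g x * trig_sum a \<theta> n (x - t) = (\<Sum>k<n. 2 * a k * cos (real (Suc k) * t) * (g x * cos (real (Suc k) * x - \<theta>))
        + 2 * a k * sin (real (Suc k) * t) * (g x * sin (real (Suc k) * x - \<theta>)))" for x
    proof -
      have "cos (real (Suc k) * (x - t) - \<theta>) = cos (real (Suc k) * x - \<theta>) * cos (real (Suc k) * t)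
          + sin (real (Suc k) * x - \<theta>) * sin (real (Suc k) * t)" for k
        unfolding cos_diff[symmetric] by (simp add: algebra_simps)
      then show ?thesis unfolding trig_sum_def sum_distrib_left
        by (intro sum.cong refl) (simp add: algebra_simps del: of_nat_Suc)
    qed
    show ?thesis
      unfolding G_def * integral_sum_lincomb[OF integrable_mult_harmonic(1,2)[OF g]]
      by (intro sum.cong refl) (simp only: ring_distribs mult_ac)
  qed
  have intG: "(\<integral>t. f t * G n t \<partial>period_measure) = ?S n" for n
  proof -
    have *: "f t * G n t = (\<Sum>k<n. 2 * a k * ?c (Suc k) * (f t * cos (real (Suc k) * t))
        + 2 * a k * ?s (Suc k) * (f t * sin (real (Suc k) * t)))" for t
      unfolding G sum_distrib_left by (intro sum.cong refl) (simp add: algebra_simps del: of_nat_Suc)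
    show ?thesis
      unfolding * integral_sum_lincomb[OF integrable_mult_harmonic(3,4)[OF f]] cos_moment_def sin_moment_def
      by (intro sum.cong refl) (simp only: ring_distribs mult_ac)
  qed
  have Glim: "(\<lambda>n. G n t) \<longlonglongrightarrow> (\<integral>x. g x * K (x - t) \<partial>period_measure)" for t
    unfolding G_def using integral_mult_K(1)[OF g, of "\<lambda>x. x - t"] by simp
  have Gborel: "G n \<in> borel_measurable borel" for n
    unfolding G[abs_def]
    by (intro borel_measurable_sum borel_measurable_times borel_measurable_add borel_measurable_harmonic) simp_all
  have "(\<lambda>n. \<integral>t. f t * G n t \<partial>period_measure)
      \<longlonglongrightarrow> (\<integral>t. f t * (\<integral>x. g x * K (x - t) \<partial>period_measure) \<partial>period_measure)" (is "_ \<longlonglongrightarrow> ?R")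
  proof (rule integral_dominated_convergence)
    let ?B = "C * (\<integral>t. \<bar>g t\<bar> \<partial>period_measure)"
    show "integrable period_measure (\<lambda>x. ?B * \<bar>f x\<bar>)" using f by simp
    show "AE t in period_measure. (\<lambda>n. f t * G n t) \<longlonglongrightarrow> f t * (\<integral>x. g x * K (x - t) \<partial>period_measure)"
      by (intro always_eventually allI tendsto_mult tendsto_const Glim)
    have "\<bar>G n x\<bar> * \<bar>f x\<bar> \<le> ?B * \<bar>f x\<bar>" for n x
      unfolding G_def by (intro mult_right_mono integral_mult_K(2) g) simp_all
    then show "\<And>n. AE x in period_measure. norm (f x * G n x) \<le> ?B * \<bar>f x\<bar>"
      by (simp add: abs_mult mult.commute)
    show "(\<lambda>t. f t * (\<integral>x. g x * K (x - t) \<partial>period_measure)) \<in> borel_measurable period_measure"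
      using f
      by (intro borel_measurable_times
          period_measure_measurable[OF borel_imp_lebesgue_measurable[OF borel_measurable_LIMSEQ_real[OF Glim Gborel]]]) auto
    show "\<And>n. (\<lambda>x. f x * G n x) \<in> borel_measurable period_measure"
      using f
      by (intro borel_measurable_times period_measure_measurable[OF borel_imp_lebesgue_measurable[OF Gborel]]) auto
  qed
  then show "?L = ?R" using LIMSEQ_unique[OF L] unfolding intG by blast
qed

end

text \<open>On a trigonometric sum, convolution with g multiplies the harmonic of frequency k + 1 by
  \<open>h k\<close>, because the sine moments of g vanish. Hence the identity holds for the finite
  sums, with coefficients b (1 - h) = a, and passes to the limit.\<close>

lemma conv_multiplier_error:
  assumes B: "bounded_series b \<theta> C\<^sub>1 \<Psi>" and A: "bounded_series a \<theta> C\<^sub>2 K"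
    and ab: "\<And>k. a k = b k * (1 - h k)"
    and f: "periodic_L1 f" and g: "integrable period_measure g"
    and gc: "\<And>k. cos_moment g (Suc k) = 2 * pi * h k" and gs: "\<And>k. sin_moment g (Suc k) = 0"
  shows "conv f \<Psi> x - conv (conv f \<Psi>) g x = conv f K x"
proof -
  interpret B: bounded_series b \<theta> C\<^sub>1 \<Psi> by fact
  interpret A: bounded_series a \<theta> C\<^sub>2 K by fact
  note fi = periodic_L1D(3)[OF f]
  \<comment> \<open>Not a derivative: \<open>h' k\<close> is the harmonic of frequency k + 1 of the
    convolution before its coefficient is attached.\<close>
  define h' where "h' k = cos (real (Suc k) * x - \<theta>) * cos_moment f (Suc k)
        + sin (real (Suc k) * x - \<theta>) * sin_moment f (Suc k)" for k
  define F where "F n x = (\<Sum>k<n. 2 * b k * (cos (real (Suc k) * x - \<theta>) * cos_moment f (Suc k)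
        + sin (real (Suc k) * x - \<theta>) * sin_moment f (Suc k)))" for n x
  define \<Phi> where "\<Phi> x = (\<integral>t. f t * \<Psi> (x - t) \<partial>period_measure)" for x
  have conv1: "conv f \<Psi> = (\<lambda>x. 1 / (2 * pi) * \<Phi> x)" unfolding \<Phi>_def using B.conv_K[OF f] by blast
  have Flim: "(\<lambda>n. F n y) \<longlonglongrightarrow> \<Phi> y" for y
    unfolding F_def \<Phi>_def by (rule B.integral_mult_K_reflect_tendsto[OF fi])
  have reflect_meas: "(\<lambda>t. G (x - t)) \<in> borel_measurable period_measure" if "G \<in> borel_measurable borel" for G :: "real \<Rightarrow> real"
    by (intro period_measure_measurable borel_imp_lebesgue_measurable measurable_compose[OF _ that]) simp
  have intF: "(\<integral>t. F n (x - t) * g t \<partial>period_measure) = 2 * pi * (\<Sum>k<n. 2 * b k * h k * h' k)" for n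
  proof -
    let ?c = "\<lambda>k. cos_moment f (Suc k)" and ?s = "\<lambda>k. sin_moment f (Suc k)"
    \<comment> \<open>Reading the sine as a cosine with phase \<theta> + \<pi>/2 lets the integral
      formula for shifted cosines treat both kinds of terms.\<close>
    have shift: "sin (real (Suc k) * y - \<theta>) = cos (real (Suc k) * y - (\<theta> + pi / 2))" for k y
      by (simp add: cos_diff sin_diff cos_add sin_add algebra_simps)
    have *: "F n (x - t) * g t = (\<Sum>k<n. 2 * b k * ?c k * (g t * cos (real (Suc k) * (x - t) - \<theta>))
        + 2 * b k * ?s k * (g t * cos (real (Suc k) * (x - t) - (\<theta> + pi / 2))))" for t
    proof -
      have lin: "2 * b k * (u * ?c k + v * ?s k) * g t = 2 * b k * ?c k * (g t * u) + 2 * b k * ?s k * (g t * v)"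
        for u v k by (simp only: ring_distribs mult_ac)
      show ?thesis unfolding F_def shift[symmetric] sum_distrib_right by (intro sum.cong refl lin)
    qed
    have "(\<integral>t. F n (x - t) * g t \<partial>period_measure)
      = (\<Sum>k<n. 2 * b k * ?c k * (cos (real (Suc k) * x - \<theta>) * (2 * pi * h k))
          + 2 * b k * ?s k * (cos (real (Suc k) * x - (\<theta> + pi / 2)) * (2 * pi * h k)))"
      unfolding * integral_sum_lincomb[OF integral_mult_cos_reflect(1,1)[OF g]] integral_mult_cos_reflect(2)[OF g]
      by (simp add: gc gs del: of_nat_Suc)
    also have "\<dots> = 2 * pi * (\<Sum>k<n. 2 * b k * h k * h' k)"
      unfolding shift[symmetric] h'_def sum_distrib_left
      by (intro sum.cong refl) (simp add: algebra_simps del: of_nat_Suc)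
    finally show ?thesis .
  qed
  have "(\<lambda>n. \<integral>t. F n (x - t) * g t \<partial>period_measure) \<longlonglongrightarrow> (\<integral>t. \<Phi> (x - t) * g t \<partial>period_measure)"
  proof (rule integral_dominated_convergence)
    let ?B = "C\<^sub>1 * (\<integral>t. \<bar>f t\<bar> \<partial>period_measure)"
    show "integrable period_measure (\<lambda>x. ?B * \<bar>g x\<bar>)" using g by simp
    show "AE t in period_measure. (\<lambda>n. F n (x - t) * g t) \<longlonglongrightarrow> \<Phi> (x - t) * g t"
      by (intro always_eventually allI tendsto_mult tendsto_const Flim)
    have "\<bar>F n y\<bar> * \<bar>g t\<bar> \<le> ?B * \<bar>g t\<bar>" for n y t
      unfolding F_def by (intro mult_right_mono B.trig_conv_bounded fi) simp_all
    then show "\<And>n. AE t in period_measure. norm (F n (x - t) * g t) \<le> ?B * \<bar>g t\<bar>"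
      by (simp add: abs_mult)
    have gm: "g \<in> borel_measurable period_measure" using g by auto
    have "\<Phi> \<in> borel_measurable borel" unfolding \<Phi>_def by (rule B.K_conv_borel[OF fi])
    then show "(\<lambda>t. \<Phi> (x - t) * g t) \<in> borel_measurable period_measure"
      by (intro borel_measurable_times reflect_meas gm)
    have "F n \<in> borel_measurable borel" for n unfolding F_def by (rule B.trig_conv_borel)
    then show "\<And>n. (\<lambda>t. F n (x - t) * g t) \<in> borel_measurable period_measure"
      by (intro borel_measurable_times reflect_meas gm)
  qed
  then have "(\<lambda>n. \<Sum>k<n. 2 * b k * h k * h' k) \<longlonglongrightarrow> 1 / (2 * pi) * (\<integral>t. \<Phi> (x - t) * g t \<partial>period_measure)"
    unfolding intF by (drule_tac tendsto_mult_left[where c = "1 / (2 * pi)"]) simp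
  from tendsto_diff[OF Flim[of x] this]
  have "(\<lambda>n. F n x - (\<Sum>k<n. 2 * b k * h k * h' k))
      \<longlonglongrightarrow> \<Phi> x - 1 / (2 * pi) * (\<integral>t. \<Phi> (x - t) * g t \<partial>period_measure)" .
  moreover have "F n x - (\<Sum>k<n. 2 * b k * h k * h' k) = (\<Sum>k<n. 2 * a k * h' k)" for n
    unfolding F_def h'_def[symmetric] ab sum_subtractf[symmetric]
    by (intro sum.cong refl) (simp add: algebra_simps)
  moreover have "(\<lambda>n. \<Sum>k<n. 2 * a k * h' k) \<longlonglongrightarrow> (\<integral>t. f t * K (x - t) \<partial>period_measure)"
    unfolding h'_def by (rule A.integral_mult_K_reflect_tendsto[OF fi])
  ultimately have "\<Phi> x - 1 / (2 * pi) * (\<integral>t. \<Phi> (x - t) * g t \<partial>period_measure)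
      = (\<integral>t. f t * K (x - t) \<partial>period_measure)"
    by (metis (no_types, lifting) LIMSEQ_unique ext)
  then have "1 / (2 * pi) * (\<Phi> x - 1 / (2 * pi) * (\<integral>t. \<Phi> (x - t) * g t \<partial>period_measure)) = conv f K x"
    unfolding A.conv_K[OF f] by simp
  moreover have "conv (\<lambda>x. 1 / (2 * pi) * \<Phi> x) g x
      = 1 / (2 * pi) * (1 / (2 * pi) * (\<integral>t. \<Phi> (x - t) * g t \<partial>period_measure))"
    unfolding conv_def by (simp add: mult.assoc)
  ultimately show ?thesis unfolding conv1 by (simp add: right_diff_distrib)
qed

subsection \<open>Test kernels and norms\<close>

lemma integral_period_antiderivative:
  assumes F: "\<And>t. (F has_real_derivative f t) (at t)" and f: "continuous_on UNIV f"
  shows "(\<integral>t. f t \<partial>period_measure) = F pi - F (- pi)"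
proof -
  have "(f has_integral (F pi - F (- pi))) {-pi..pi}"
    using F by (intro fundamental_theorem_of_calculus)
      (auto simp: has_real_derivative_iff_has_vector_derivative[symmetric] intro: has_field_derivative_at_within)
  moreover have "integrable period_measure f"
    by (intro continuous_imp_integrable_real continuous_on_subset[OF f]) simp
  ultimately show ?thesis by (simp add: lebesgue_integral_eq_integral integral_unique)
qed

lemma sin_harmonic_pi: "sin (real k * pi) = 0"
  by (rule sin_npi)

lemma integral_cos_harmonic: "(\<integral>t. cos (real k * t) \<partial>period_measure) = (if k = 0 then 2 * pi else 0)"
proof (cases "k = 0")
  case True
  then show ?thesis using integral_period_const[of 1] by simp
next
  case False
  then have "(\<integral>t. cos (real k * t) \<partial>period_measure) = sin (real k * pi) / real k - sin (real k * - pi) / real k"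
    by (intro integral_period_antiderivative[where F = "\<lambda>t. sin (real k * t) / real k"])
      (auto intro!: derivative_eq_intros continuous_intros)
  then show ?thesis using False by simp
qed

lemma integrable_harmonic:
  "integrable period_measure (\<lambda>t. cos (a * t))" "integrable period_measure (\<lambda>t. sin (a * t))" for a :: real
  by (intro integrable_period_bounded[where C = 1] borel_imp_lebesgue_measurable; simp)+

lemma cos_moment_cos: "cos_moment (\<lambda>t. cos (real (Suc j) * t)) (Suc k) = (if j = k then pi else 0)"
proof -
  \<comment> \<open>The difference frequency is written as the natural number |j - k| so that the
    integral of a single harmonic applies to it.\<close>
  have "cos (real (Suc j) * t) * cos (real (Suc k) * t)
      = 1 / 2 * cos (real (nat \<bar>int j - int k\<bar>) * t) + 1 / 2 * cos (real (j + k + 2) * t)" for t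
  proof -
    have "cos (real (nat \<bar>int j - int k\<bar>) * t) = cos ((real j - real k) * t)"
      by (cases "j \<ge> k") (auto simp: of_nat_diff nat_diff_distrib abs_if algebra_simps intro: cos_minus[THEN trans[rotated]])
    also have "\<dots> = cos (real (Suc j) * t - real (Suc k) * t)" by (simp add: algebra_simps)
    finally have 1: "cos (real (nat \<bar>int j - int k\<bar>) * t) = \<dots>" .
    have 2: "cos (real (j + k + 2) * t) = cos (real (Suc j) * t + real (Suc k) * t)" by (simp add: algebra_simps)
    show ?thesis unfolding 1 2 cos_add cos_diff by (simp add: field_simps)
  qed
  then have "cos_moment (\<lambda>t. cos (real (Suc j) * t)) (Suc k)
      = 1 / 2 * (\<integral>t. cos (real (nat \<bar>int j - int k\<bar>) * t) \<partial>period_measure)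
        + 1 / 2 * (\<integral>t. cos (real (j + k + 2) * t) \<partial>period_measure)"
    unfolding cos_moment_def using integrable_harmonic(1) by simp
  also have "\<dots> = (if j = k then pi else 0)" unfolding integral_cos_harmonic by auto
  finally show ?thesis .
qed

text \<open>The integrand is odd, and its integral over a period is invariant under
  reflection.\<close>

lemma sin_moment_cos: "sin_moment (\<lambda>t. cos (real (Suc j) * t)) (Suc k) = 0"
proof -
  define u where "u t = cos (real (Suc j) * t) * sin (real (Suc k) * t)" for t
  have "periodic_L1 u"
  proof (rule periodic_L1I[where C = 1])
    show "u \<in> borel_measurable lebesgue" unfolding u_def
      by (intro borel_imp_lebesgue_measurable borel_measurable_times borel_measurable_harmonic)
    show "u (t + 2 * pi) = u t" for t
      unfolding u_def sin_harmonic_periodic using cos_harmonic_periodic[of "Suc j" t 0] by (simp del: of_nat_Suc)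
    show "\<bar>u t\<bar> \<le> 1" for t unfolding u_def abs_mult by (intro mult_le_one) auto
  qed
  from periodic_L1_reflect(2)[OF this, of 0] have "(\<integral>t. u t \<partial>period_measure) = 0"
    unfolding u_def by simp
  then show ?thesis unfolding sin_moment_def u_def .
qed

text \<open>Fejer weights on the odd frequencies only. Since k counts from zero, even k stands for
  the odd frequency k + 1.\<close>

definition test_weight :: "nat \<Rightarrow> nat \<Rightarrow> real" where
  "test_weight n k = (if even k \<and> k < n then 1 - real (Suc k) / real n else 0)"

text \<open>Half the difference of the normalised Fejer kernel and its translate by \<open>\<pi>\<close>: a smooth
  approximation to half the difference of the point masses at \<open>0\<close> and \<open>\<pi>\<close>.\<close>

definition test_kernel :: "nat \<Rightarrow> real \<Rightarrow> real" where
  "test_kernel n t = (fejer n t - fejer n (t + pi)) / (4 * pi * real n)"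

lemma cos_harmonic_plus_pi: "cos (real k * (t + pi)) = (-1) ^ k * cos (real k * t)"
  by (simp add: distrib_left cos_add cos_npi)

lemma test_kernel_expansion: "test_kernel n t = 1 / pi * (\<Sum>k<n. test_weight n k * cos (real (Suc k) * t))"
proof -
  have "fejer n t - fejer n (t + pi)
      = (\<Sum>k<n. 2 * (real n - real (Suc k)) * (1 - (-1) ^ Suc k) * cos (real (Suc k) * t))"
    unfolding fejer_def cos_harmonic_plus_pi
    by (simp add: sum_distrib_left sum_subtractf[symmetric] algebra_simps del: of_nat_Suc)
  also have "\<dots> = (\<Sum>k<n. 4 * real n * (test_weight n k * cos (real (Suc k) * t)))"
    unfolding test_weight_def by (intro sum.cong refl) (auto simp: field_simps simp del: of_nat_Suc)
  finally show ?thesis unfolding test_kernel_def sum_distrib_left[symmetric] by (cases "n = 0") simp_all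
qed

lemma test_kernel_borel: "test_kernel n \<in> borel_measurable borel"
  unfolding test_kernel_expansion[abs_def]
  by (intro borel_measurable_times borel_measurable_sum borel_measurable_harmonic) simp_all

lemma fejer_periodic: "fejer n (t + 2 * pi) = fejer n t"
  unfolding fejer_def using cos_harmonic_periodic[where \<theta> = 0] by (simp del: of_nat_Suc)

lemma integral_fejer:
  "integrable period_measure (fejer n)" "(\<integral>t. fejer n t \<partial>period_measure) = 2 * pi * real n"
proof -
  have "integrable period_measure (\<lambda>t. real n)" by (intro integrable_period_bounded[where C = "real n"]) auto
  then show "integrable period_measure (fejer n)" "(\<integral>t. fejer n t \<partial>period_measure) = 2 * pi * real n"
    unfolding fejer_def[abs_def]
    by (auto simp: integrable_harmonic integral_cos_harmonic integral_period_const Bochner_Integration.integral_sum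
        simp del: of_nat_Suc lebesgue_integral_const)
qed

lemma fejer_periodic_L1: "periodic_L1 (fejer n)"
  unfolding periodic_L1_def using integral_fejer(1) fejer_periodic
  by (auto simp: fejer_def[abs_def] intro!: borel_imp_lebesgue_measurable borel_measurable_add borel_measurable_times
      borel_measurable_sum borel_measurable_harmonic simp del: of_nat_Suc)

lemma test_kernel_periodic_L1: "periodic_L1 (test_kernel n)"
proof -
  have "integrable period_measure (test_kernel n)"
    unfolding test_kernel_expansion[abs_def] using integrable_harmonic(1) by (simp del: of_nat_Suc)
  moreover have "test_kernel n (t + 2 * pi) = test_kernel n t" for t
    unfolding test_kernel_def using fejer_periodic[of n t] fejer_periodic[of n "t + pi"] by (simp add: algebra_simps)
  ultimately show ?thesis
    unfolding periodic_L1_def using borel_imp_lebesgue_measurable[OF test_kernel_borel] by blast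
qed

lemma test_kernel_moments:
  "cos_moment (test_kernel n) (Suc k) = test_weight n k" "sin_moment (test_kernel n) (Suc k) = 0"
  "(\<integral>t. test_kernel n t \<partial>period_measure) = 0"
proof -
  have *: "test_kernel n t * u = (\<Sum>j<n. 1 / pi * test_weight n j * (cos (real (Suc j) * t) * u))" for t u
    unfolding test_kernel_expansion sum_distrib_left sum_distrib_right by (simp add: mult.assoc)
  have int: "integrable period_measure (\<lambda>t. cos (real (Suc j) * t) * cos (real k * t))"
    "integrable period_measure (\<lambda>t. cos (real (Suc j) * t) * sin (real k * t))" for j k
    by (intro integrable_mult_harmonic integrable_harmonic)+
  have "cos_moment (test_kernel n) (Suc k)
      = (\<Sum>j<n. 1 / pi * test_weight n j * cos_moment (\<lambda>t. cos (real (Suc j) * t)) (Suc k))"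
    unfolding cos_moment_def * using int by (simp add: Bochner_Integration.integral_sum del: of_nat_Suc)
  also have "\<dots> = (\<Sum>j<n. if j = k then test_weight n k else 0)"
    unfolding cos_moment_cos by (intro sum.cong) auto
  also have "\<dots> = test_weight n k" by (auto simp: test_weight_def)
  finally show "cos_moment (test_kernel n) (Suc k) = test_weight n k" .
  have "sin_moment (test_kernel n) (Suc k)
      = (\<Sum>j<n. 1 / pi * test_weight n j * sin_moment (\<lambda>t. cos (real (Suc j) * t)) (Suc k))"
    unfolding sin_moment_def * using int by (simp add: Bochner_Integration.integral_sum del: of_nat_Suc)
  then show "sin_moment (test_kernel n) (Suc k) = 0" unfolding sin_moment_cos by simp
  show "(\<integral>t. test_kernel n t \<partial>period_measure) = 0"
    unfolding test_kernel_expansion using integrable_harmonic(1) integral_cos_harmonic[of "Suc k" for k]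
    by (simp add: Bochner_Integration.integral_sum del: of_nat_Suc)
qed

text \<open>Both Fejer kernels are nonnegative, so the modulus of their difference is at most their
  sum, whose integral is 4 \<pi> n. For n = 0 the kernel is 0 by the convention on division.\<close>

lemma integral_abs_test_kernel: "(\<integral>t. \<bar>test_kernel n t\<bar> \<partial>period_measure) \<le> 1"
proof (cases "n = 0")
  case False
  \<comment> \<open>Evenness turns the translate into a reflection, whose integrability is already
    known.\<close>
  have f: "fejer n (t + pi) = fejer n (- pi - t)" for t
  proof -
    have "fejer n (- pi - t) = fejer n (t + pi)" unfolding fejer_def using cos_minus[of "real (Suc k) * (t + pi)" for k]
      by (simp add: algebra_simps del: of_nat_Suc)
    then show ?thesis ..
  qed
  have int2: "integrable period_measure (\<lambda>t. fejer n (t + pi))"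
    unfolding f by (rule periodic_L1_reflect(1)[OF fejer_periodic_L1])
  have "(\<integral>t. \<bar>test_kernel n t\<bar> \<partial>period_measure)
      \<le> (\<integral>t. 1 / (4 * pi * real n) * (fejer n t + fejer n (t + pi)) \<partial>period_measure)"
  proof (rule integral_mono)
    show "integrable period_measure (\<lambda>t. \<bar>test_kernel n t\<bar>)"
      using periodic_L1D(3)[OF test_kernel_periodic_L1] by simp
    show "integrable period_measure (\<lambda>t. 1 / (4 * pi * real n) * (fejer n t + fejer n (t + pi)))"
      using int2 integral_fejer(1) by simp
    show "\<bar>test_kernel n t\<bar> \<le> 1 / (4 * pi * real n) * (fejer n t + fejer n (t + pi))" for t
    proof -
      have "\<bar>fejer n t - fejer n (t + pi)\<bar> \<le> fejer n t + fejer n (t + pi)"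
        using fejer_nonneg[of n t] fejer_nonneg[of n "t + pi"] by linarith
      then show ?thesis unfolding test_kernel_def by (simp add: abs_divide divide_right_mono)
    qed
  qed
  also have "\<dots> = 1 / (4 * pi * real n) * (2 * pi * real n + 2 * pi * real n)"
    using int2 integral_fejer periodic_L1_translate[OF fejer_periodic_L1] by simp
  also have "\<dots> = 1" using False by (simp add: field_simps)
  finally show ?thesis by simp
qed (simp add: test_kernel_def)

lemma test_weight_tendsto: "(\<lambda>n. test_weight n k) \<longlonglongrightarrow> (if even k then 1 else 0)"
proof (cases "even k")
  case True
  have "(\<lambda>n. 1 - real (Suc k) / real n) \<longlonglongrightarrow> 1 - 0"
    by (intro tendsto_diff tendsto_const lim_const_over_n)
  moreover have "eventually (\<lambda>n. 1 - real (Suc k) / real n = test_weight n k) sequentially"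
    using eventually_gt_at_top[of k] by eventually_elim (use True in \<open>simp add: test_weight_def\<close>)
  ultimately show ?thesis using True by (simp add: tendsto_cong)
qed (simp add: test_weight_def)

lemma test_weight_bounds: "\<bar>test_weight n k\<bar> \<le> 1"
  unfolding test_weight_def by (auto simp: field_simps)

section \<open>The two norms and the unit ball of mean-zero functions\<close>

lemma Lp_norm_1:
  assumes f: "f \<in> borel_measurable lebesgue"
  shows "integrable period_measure f \<Longrightarrow> Lp_norm 1 f = ereal (\<integral>t. \<bar>f t\<bar> \<partial>period_measure)"
    and "Lp_norm 1 f < \<infinity> \<Longrightarrow> integrable period_measure f"
proof -
  have *: "(\<integral>\<^sup>+t. ennreal (\<bar>f t\<bar> powr real_of_ereal 1) \<partial>period_measure) = (\<integral>\<^sup>+t. ennreal (norm (f t)) \<partial>period_measure)"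
    by simp
  have "1 \<noteq> (\<infinity>::ereal)" by simp
  note norm_eq = Lp_norm_def[of 1 f, unfolded * if_not_P[OF \<open>1 \<noteq> (\<infinity>::ereal)\<close>] Let_def]
  { assume "integrable period_measure f"
    then have "(\<integral>\<^sup>+t. ennreal (norm (f t)) \<partial>period_measure) = ennreal (\<integral>t. \<bar>f t\<bar> \<partial>period_measure)"
      by (subst nn_integral_eq_integral) auto
    then show "Lp_norm 1 f = ereal (\<integral>t. \<bar>f t\<bar> \<partial>period_measure)" unfolding norm_eq by simp }
  assume "Lp_norm 1 f < \<infinity>"
  then have "(\<integral>\<^sup>+t. ennreal (norm (f t)) \<partial>period_measure) < \<infinity>"
    unfolding norm_eq by (auto simp: less_top split: if_splits)
  then show "integrable period_measure f"
    unfolding integrable_iff_bounded using period_measure_measurable[OF f] by blast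
qed

lemma Lp_norm_infinity_le_iff:
  assumes f: "f \<in> borel_measurable lebesgue"
  shows "Lp_norm \<infinity> f \<le> ereal c \<longleftrightarrow> (AE t in period_measure. \<bar>f t\<bar> \<le> c)"
proof -
  have m: "(\<lambda>t. ereal \<bar>f t\<bar>) \<in> borel_measurable period_measure"
    using period_measure_measurable[OF f] by simp
  have "Lp_norm \<infinity> f = esssup period_measure (\<lambda>t. ereal \<bar>f t\<bar>)" unfolding Lp_norm_def by simp
  moreover have "esssup period_measure (\<lambda>t. ereal \<bar>f t\<bar>) \<le> ereal c" if "AE t in period_measure. \<bar>f t\<bar> \<le> c"
    using esssup_I[OF m, of "ereal c"] that by simp
  moreover have "AE t in period_measure. \<bar>f t\<bar> \<le> c" if "esssup period_measure (\<lambda>t. ereal \<bar>f t\<bar>) \<le> ereal c"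
    using esssup_AE[of "\<lambda>t. ereal \<bar>f t\<bar>" period_measure]
    by eventually_elim (use that in \<open>meson ereal_less_eq(3) order_trans\<close>)
  ultimately show ?thesis by metis
qed

lemma fourier_coeff_0: "fourier_coeff f 0 = of_real (1 / (2 * pi) * (\<integral>t. f t \<partial>period_measure))"
  unfolding fourier_coeff_def by simp

text \<open>For p = \<infinity>, integrability follows from the bound almost everywhere because the
  period has finite measure. The hypothesis of vanishing mean is read off the zeroth Fourier
  coefficient.\<close>

lemma H1_D:
  assumes "f \<in> H1 p" "p \<in> {1, \<infinity>}"
  shows "periodic_L1 f" "(\<integral>t. f t \<partial>period_measure) = 0"
    "p = 1 \<Longrightarrow> (\<integral>t. \<bar>f t\<bar> \<partial>period_measure) \<le> 1" "p = \<infinity> \<Longrightarrow> AE t in period_measure. \<bar>f t\<bar> \<le> 1"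
proof -
  have f: "f \<in> borel_measurable lebesgue" "\<And>x. f (x + 2 * pi) = f x" "Lp_norm p f < \<infinity>" "Lp_norm p f \<le> 1"
    and c: "fourier_coeff f 0 = 0"
    using assms(1) unfolding H1_def Lp_def by auto
  show AE: "AE t in period_measure. \<bar>f t\<bar> \<le> 1" if "p = \<infinity>"
    using f(4) that Lp_norm_infinity_le_iff[OF f(1), of 1] by (simp add: one_ereal_def)
  have int: "integrable period_measure f"
  proof (cases "p = 1")
    case False
    then have "AE t in period_measure. norm (f t) \<le> 1" using AE assms(2) by simp
    then show ?thesis
      by (intro finite_measure.integrable_const_bound[OF finite_period_measure] period_measure_measurable f(1))
  qed (use Lp_norm_1(2)[OF f(1)] f(3) in blast)
  then show "periodic_L1 f" unfolding periodic_L1_def using f by blast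
  show "(\<integral>t. f t \<partial>period_measure) = 0" using c unfolding fourier_coeff_0 by simp
  show "p = 1 \<Longrightarrow> (\<integral>t. \<bar>f t\<bar> \<partial>period_measure) \<le> 1"
    using f(4) Lp_norm_1(1)[OF f(1) int] by (simp add: one_ereal_def)
qed

lemma H1_I:
  assumes f: "periodic_L1 f" "(\<integral>t. f t \<partial>period_measure) = 0"
    and p: "p = 1 \<and> (\<integral>t. \<bar>f t\<bar> \<partial>period_measure) \<le> 1 \<or> p = \<infinity> \<and> (\<forall>t. \<bar>f t\<bar> \<le> 1)"
  shows "f \<in> H1 p"
proof -
  have "Lp_norm p f \<le> 1"
    using p Lp_norm_1(1)[OF periodic_L1D(1,3)[OF f(1)]] Lp_norm_infinity_le_iff[OF periodic_L1D(1)[OF f(1)], of 1]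
    by (auto simp: one_ereal_def)
  moreover from this have "Lp_norm p f < \<infinity>" by (rule order_le_less_trans) simp
  ultimately show ?thesis
    unfolding H1_def Lp_def fourier_coeff_0 using f periodic_L1D[OF f(1)] by auto
qed

subsection \<open>Kernels with a known sign\<close>

text \<open>The function \<open>s\<close> is the extremal sign: it is orthogonal to constants, and the constant \<open>c\<close> is the
  best \<open>L\<^sub>1\<close> approximation of \<open>K\<close> because \<open>\<eta> * s\<close> is the sign of \<open>K - c\<close>.\<close>

locale extremal_kernel = bounded_series +
  fixes s :: "real \<Rightarrow> real" and \<eta> c :: real
  assumes s_borel: "s \<in> borel_measurable borel"
    and s_bounded: "\<bar>s t\<bar> \<le> 1"
    and s_antiperiodic: "s (t + pi) = - s t"
    and eta: "\<bar>\<eta>\<bar> = 1"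
    and sign: "(K t - c) * (\<eta> * s t) = \<bar>K t - c\<bar>"
    and summable_moments: "summable (\<lambda>k. \<bar>a k * (\<integral>t. s t * cos (real (Suc k) * t - \<theta>) \<partial>period_measure)\<bar>)"
begin

text \<open>Taken with the phase \<theta> of the kernel, so that the integral of s K is the sum of
  \<open>2 * a k * \<sigma> k\<close>.\<close>

definition \<sigma> :: "nat \<Rightarrow> real" where
  "\<sigma> k = (\<integral>t. s t * cos (real (Suc k) * t - \<theta>) \<partial>period_measure)"

text \<open>Turns out to be the supremum for p = 1 and p = \<infinity> alike; the factor 1/(2\<pi>)
  is the one in \<open>conv\<close>.\<close>

definition M :: real where
  "M = 1 / (2 * pi) * (\<integral>t. \<bar>K t - c\<bar> \<partial>period_measure)"

lemma s_periodic_L1: "periodic_L1 s"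
proof (rule periodic_L1I[OF borel_imp_lebesgue_measurable[OF s_borel] _ s_bounded])
  show "s (t + 2 * pi) = s t" for t
    using s_antiperiodic[of t] s_antiperiodic[of "t + pi"] by (simp add: algebra_simps)
qed

lemma integral_s: "(\<integral>t. s t \<partial>period_measure) = 0"
  by (rule integral_antiperiodic[OF s_periodic_L1 s_antiperiodic])

text \<open>For odd k the frequency k + 1 is even, so the cosine has period \<pi> while s changes
  sign under translation by \<pi>.\<close>

lemma \<sigma>_odd: "odd k \<Longrightarrow> \<sigma> k = 0"
  unfolding \<sigma>_def
proof (rule integral_antiperiodic)
  show "periodic_L1 (\<lambda>t. s t * cos (real (Suc k) * t - \<theta>))"
    by (rule periodic_L1_mult_bounded[OF s_periodic_L1, of _ 1])
      (intro borel_imp_lebesgue_measurable borel_measurable_harmonic cos_harmonic_periodic abs_cos_le_one)+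
next
  fix t assume "odd k"
  then obtain j where "Suc k = 2 * j" by (meson even_Suc evenE)
  then have eq: "real (Suc k) * (t + pi) - \<theta> = real (Suc k) * t - \<theta> + 2 * pi * real_of_int (int j)"
    by (simp add: algebra_simps)
  show "s (t + pi) * cos (real (Suc k) * (t + pi) - \<theta>) = - (s t * cos (real (Suc k) * t - \<theta>))"
    unfolding eq using periodic_int_shift[of cos "real (Suc k) * t - \<theta>" "int j"]
    by (simp add: s_antiperiodic del: of_nat_Suc)
qed

lemma summable_\<sigma>: "summable (\<lambda>k. \<bar>2 * a k * \<sigma> k\<bar>)"
  using summable_mult[OF summable_moments, of 2] unfolding \<sigma>_def by (simp add: abs_mult mult.assoc)

lemma K_minus_c: "periodic_L1 (\<lambda>t. K t - c)" "periodic_L1 (\<lambda>t. \<bar>K t - c\<bar>)"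
proof -
  have "\<bar>K t - c\<bar> \<le> C + \<bar>c\<bar>" "\<bar>\<bar>K t - c\<bar>\<bar> \<le> C + \<bar>c\<bar>" for t using K_bounded[of t] by auto
  then show "periodic_L1 (\<lambda>t. K t - c)" "periodic_L1 (\<lambda>t. \<bar>K t - c\<bar>)"
    by (auto intro!: periodic_L1I borel_imp_lebesgue_measurable borel_measurable_diff borel_measurable_abs
        K_borel simp: K_periodic)
qed

text \<open>Replace |K - c| by (K - c) times its sign \<eta> s. The constant drops out since s has
  mean zero, and the remaining integral of s K is taken term by term.\<close>

lemma M_eq: "2 * pi * M = \<eta> * (\<Sum>k. 2 * a k * \<sigma> k)"
proof -
  have s: "integrable period_measure s" by (rule periodic_L1D(3)[OF s_periodic_L1])
  have "(\<lambda>n. \<Sum>k<n. 2 * a k * \<sigma> k) \<longlonglongrightarrow> (\<integral>t. s t * K t \<partial>period_measure)"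
  proof -
    have "(\<integral>t. s t * trig_sum a \<theta> n t \<partial>period_measure) = (\<Sum>k<n. 2 * a k * \<sigma> k)" for n
    proof -
      have "s t * trig_sum a \<theta> n t = (\<Sum>k<n. 2 * a k * (s t * cos (real (Suc k) * t - \<theta>)))" for t
        unfolding trig_sum_def sum_distrib_left by (intro sum.cong refl) (simp only: mult_ac)
      then show ?thesis unfolding \<sigma>_def using integrable_mult_harmonic(1)[OF s]
        by (simp add: Bochner_Integration.integral_sum del: of_nat_Suc)
    qed
    then show ?thesis using integral_mult_K(1)[OF s, of "\<lambda>t. t"] by simp
  qed
  moreover have "(\<lambda>n. \<Sum>k<n. 2 * a k * \<sigma> k) \<longlonglongrightarrow> (\<Sum>k. 2 * a k * \<sigma> k)"
    by (rule summable_LIMSEQ[OF summable_rabs_cancel[OF summable_\<sigma>]])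
  ultimately have sK: "(\<integral>t. s t * K t \<partial>period_measure) = (\<Sum>k. 2 * a k * \<sigma> k)"
    by (rule LIMSEQ_unique)
  have "2 * pi * M = (\<integral>t. (K t - c) * (\<eta> * s t) \<partial>period_measure)"
    unfolding sign M_def by simp
  also have "\<dots> = (\<integral>t. \<eta> * (s t * K t) - c * \<eta> * s t \<partial>period_measure)"
    by (simp add: algebra_simps)
  also have "\<dots> = \<eta> * (\<integral>t. s t * K t \<partial>period_measure) - c * \<eta> * (\<integral>t. s t \<partial>period_measure)"
    using s integral_mult_K(3)[OF s, of "\<lambda>t. t"] by simp
  finally show ?thesis unfolding sK integral_s by simp
qed

section \<open>Upper bounds for both norms\<close>

lemma integral_translate_abs: "(\<integral>x. \<bar>K (x - t) - c\<bar> \<partial>period_measure) = 2 * pi * M"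
  using periodic_L1_translate[OF K_minus_c(2), of "- t"] unfolding M_def by simp

lemma integral_reflect_abs: "(\<integral>t. \<bar>K (x - t) - c\<bar> \<partial>period_measure) = 2 * pi * M"
  using periodic_L1_reflect(2)[OF K_minus_c(2), of x] unfolding M_def by simp

lemma integral_mult_K_shifted:
  assumes f: "integrable period_measure f" and \<tau>: "\<tau> \<in> borel_measurable borel"
  shows "integrable period_measure (\<lambda>t. f t * (K (\<tau> t) - c))"
    and "(\<integral>t. f t * (K (\<tau> t) - c) \<partial>period_measure)
      = (\<integral>t. f t * K (\<tau> t) \<partial>period_measure) - c * (\<integral>t. f t \<partial>period_measure)"
  using integral_mult_K(3)[OF f \<tau>] f by (simp_all add: right_diff_distrib mult.commute)

lemma integrable_abs_K_shifted:
  assumes \<tau>: "\<tau> \<in> borel_measurable borel"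
  shows "integrable period_measure (\<lambda>t. \<bar>K (\<tau> t) - c\<bar>)"
proof -
  have "integrable period_measure (\<lambda>t. 1::real)" by (rule integrable_period_bounded[where C = 1]) auto
  from integral_mult_K_shifted(1)[OF this \<tau>] show ?thesis by simp
qed

text \<open>Mean zero of f allows K to be replaced by K - c before the modulus is taken; this is
  what makes the bound sharp.\<close>

lemma conv_K_bound_infinity:
  assumes f: "periodic_L1 f" "(\<integral>t. f t \<partial>period_measure) = 0" "AE t in period_measure. \<bar>f t\<bar> \<le> 1"
  shows "\<bar>conv f K x\<bar> \<le> M"
proof -
  note fi = periodic_L1D(3)[OF f(1)]
  have \<tau>: "(\<lambda>t. x - t) \<in> borel_measurable borel" by simp
  have "\<bar>\<integral>t. f t * K (x - t) \<partial>period_measure\<bar> = \<bar>\<integral>t. f t * (K (x - t) - c) \<partial>period_measure\<bar>"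
    using integral_mult_K_shifted(2)[OF fi \<tau>] f(2) by simp
  also have "\<dots> \<le> (\<integral>t. \<bar>f t * (K (x - t) - c)\<bar> \<partial>period_measure)"
    using integral_norm_bound[of period_measure "\<lambda>t. f t * (K (x - t) - c)"] by simp
  also have "\<dots> \<le> (\<integral>t. \<bar>K (x - t) - c\<bar> \<partial>period_measure)"
  proof (rule integral_mono_AE)
    show "integrable period_measure (\<lambda>t. \<bar>f t * (K (x - t) - c)\<bar>)"
      using integral_mult_K_shifted(1)[OF fi \<tau>] by simp
    show "AE t in period_measure. \<bar>f t * (K (x - t) - c)\<bar> \<le> \<bar>K (x - t) - c\<bar>"
      using f(3) by eventually_elim (simp add: abs_mult mult_left_le_one_le)
  qed (rule integrable_abs_K_shifted[OF \<tau>])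
  finally show ?thesis
    unfolding conv_K[OF f(1)] integral_reflect_abs by (simp add: abs_mult field_simps)
qed

text \<open>Duality: the L1 norm of the convolution is its integral against its own sign. After the
  interchange the sign is integrated against K - c, which is bounded by 2 \<pi> M; the contribution
  of c does not depend on t and is annihilated by f.\<close>

lemma conv_K_bound_1:
  assumes f: "periodic_L1 f" "(\<integral>t. f t \<partial>period_measure) = 0" "(\<integral>t. \<bar>f t\<bar> \<partial>period_measure) \<le> 1"
  shows "(\<integral>t. \<bar>conv f K t\<bar> \<partial>period_measure) \<le> M"
proof -
  note fi = periodic_L1D(3)[OF f(1)]
  define F where "F x = (\<integral>t. f t * K (x - t) \<partial>period_measure)" for x
  have F: "F \<in> borel_measurable borel" unfolding F_def by (rule K_conv_borel[OF fi])
  have sg: "integrable period_measure (\<lambda>x. sgn (F x))"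
    by (rule integrable_period_bounded[where C = 1])
      (use F in \<open>auto intro!: borel_imp_lebesgue_measurable measurable_compose[OF F borel_measurable_sgn] simp: abs_sgn_eq\<close>)
  define V where "V t = (\<integral>x. sgn (F x) * (K (x - t) - c) \<partial>period_measure)" for t
  have V_bound: "\<bar>V t\<bar> \<le> 2 * pi * M" for t
  proof -
    have \<tau>: "(\<lambda>x. x - t) \<in> borel_measurable borel" by simp
    have "\<bar>V t\<bar> \<le> (\<integral>x. \<bar>sgn (F x) * (K (x - t) - c)\<bar> \<partial>period_measure)"
      unfolding V_def using integral_norm_bound[of period_measure "\<lambda>x. sgn (F x) * (K (x - t) - c)"] by simp
    also have "\<dots> \<le> (\<integral>x. \<bar>K (x - t) - c\<bar> \<partial>period_measure)"
      by (intro integral_mono integrable_abs_K_shifted \<tau> integrable_abs integral_mult_K_shifted(1) sg)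
        (auto simp: abs_mult abs_sgn_eq)
    finally show ?thesis unfolding integral_translate_abs .
  qed
  have V_eq: "(\<integral>x. sgn (F x) * K (x - t) \<partial>period_measure) = V t + c * (\<integral>x. sgn (F x) \<partial>period_measure)" for t
    unfolding V_def using integral_mult_K_shifted(2)[OF sg, of "\<lambda>x. x - t"] by simp
  \<comment> \<open>Up to a constant, V is a pointwise limit of trigonometric polynomials in
    t.\<close>
  have Vm: "V \<in> borel_measurable borel"
  proof -
    have "(\<lambda>t. \<integral>x. sgn (F x) * trig_sum a \<theta> n (x - t) \<partial>period_measure) \<in> borel_measurable borel" for n
    proof -
      have *: "sgn (F x) * trig_sum a \<theta> n (x - t) = (\<Sum>k<n. 2 * a k * cos (real (Suc k) * t) * (sgn (F x) * cos (real (Suc k) * x - \<theta>))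
          + 2 * a k * sin (real (Suc k) * t) * (sgn (F x) * sin (real (Suc k) * x - \<theta>)))" for x t
      proof -
        have "cos (real (Suc k) * (x - t) - \<theta>) = cos (real (Suc k) * x - \<theta>) * cos (real (Suc k) * t)
            + sin (real (Suc k) * x - \<theta>) * sin (real (Suc k) * t)" for k
          unfolding cos_diff[symmetric] by (simp add: algebra_simps)
        then show ?thesis unfolding trig_sum_def sum_distrib_left
          by (intro sum.cong refl) (simp add: algebra_simps del: of_nat_Suc)
      qed
      show ?thesis
        unfolding * integral_sum_lincomb[OF integrable_mult_harmonic(1,2)[OF sg]]
        by (intro borel_measurable_sum borel_measurable_times borel_measurable_add borel_measurable_harmonic) simp_all
    qed
    then have "(\<lambda>t. \<integral>x. sgn (F x) * K (x - t) \<partial>period_measure) \<in> borel_measurable borel"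
      by (rule borel_measurable_LIMSEQ_real[rotated]) (rule integral_mult_K(1)[OF sg], simp)
    then have "(\<lambda>t. (V t + c * (\<integral>x. sgn (F x) \<partial>period_measure)) - c * (\<integral>x. sgn (F x) \<partial>period_measure)) \<in> borel_measurable borel"
      unfolding V_eq by (intro borel_measurable_diff) auto
    then show ?thesis by simp
  qed
  have fV: "integrable period_measure (\<lambda>t. f t * V t)"
    by (rule integrable_mult_bounded[OF fi borel_imp_lebesgue_measurable[OF Vm] V_bound])
  have "(\<integral>x. \<bar>F x\<bar> \<partial>period_measure) = (\<integral>x. sgn (F x) * F x \<partial>period_measure)"
    by (intro Bochner_Integration.integral_cong refl) (simp add: abs_sgn mult.commute)
  also have "\<dots> = (\<integral>t. f t * (\<integral>x. sgn (F x) * K (x - t) \<partial>period_measure) \<partial>period_measure)"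
    using bilinear_swap[OF fi sg] unfolding F_def[symmetric] .
  also have "\<dots> = (\<integral>t. f t * V t + c * (\<integral>x. sgn (F x) \<partial>period_measure) * f t \<partial>period_measure)"
    unfolding V_eq by (simp add: algebra_simps)
  also have "\<dots> = (\<integral>t. f t * V t \<partial>period_measure)" using fV fi f(2) by simp
  also have "\<dots> \<le> (\<integral>t. 2 * pi * M * \<bar>f t\<bar> \<partial>period_measure)"
  proof (rule integral_mono[OF fV])
    show "integrable period_measure (\<lambda>t. 2 * pi * M * \<bar>f t\<bar>)" using fi by simp
    show "f t * V t \<le> 2 * pi * M * \<bar>f t\<bar>" for t
      using mult_left_mono[OF V_bound[of t], of "\<bar>f t\<bar>"] abs_le_D1[of "f t * V t" "\<bar>f t\<bar> * \<bar>V t\<bar>"]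
      by (simp add: abs_mult mult.commute)
  qed
  also have "\<dots> \<le> 2 * pi * M * 1"
  proof -
    have "0 \<le> M" unfolding M_def by simp
    then show ?thesis using mult_left_mono[OF f(3), of "2 * pi * M"] by simp
  qed
  finally show ?thesis
    unfolding conv_K[OF f(1)] F_def[symmetric] by (simp add: abs_mult field_simps)
qed

section \<open>Lower bounds by duality\<close>

lemma test_sum_tendsto: "(\<lambda>n. \<Sum>k. 2 * a k * \<sigma> k * test_weight n k) \<longlonglongrightarrow> 2 * pi * \<eta> * M"
proof -
  have "(\<lambda>n. \<Sum>k. 2 * a k * \<sigma> k * test_weight n k) \<longlonglongrightarrow> (\<Sum>k. 2 * a k * \<sigma> k)"
  \<comment> \<open>The weights tend to 1 exactly where \<open>\<sigma>\<close> can be nonzero, and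
    all of them are bounded by 1, so the absolutely summable series of
    \<open>2 * a k * \<sigma> k\<close> dominates uniformly in n.\<close>
  proof (rule tannerys_theorem[THEN conjunct2, THEN conjunct2])
    show "(\<lambda>n. 2 * a k * \<sigma> k * test_weight n k) \<longlonglongrightarrow> 2 * a k * \<sigma> k" for k
      using tendsto_mult[OF tendsto_const test_weight_tendsto, of "2 * a k * \<sigma> k" k] \<sigma>_odd[of k] by (auto split: if_splits)
    have "norm (2 * a k * \<sigma> k * test_weight n k) \<le> \<bar>2 * a k * \<sigma> k\<bar>" for k n
      using mult_left_mono[OF test_weight_bounds[of n k], of "\<bar>2 * a k * \<sigma> k\<bar>"] by (simp add: abs_mult)
    then show "eventually (\<lambda>(k, n). norm (2 * a k * \<sigma> k * test_weight n k) \<le> \<bar>2 * a k * \<sigma> k\<bar>) (at_top \<times>\<^sub>F sequentially)"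
      by (intro always_eventually) auto
  qed (use summable_\<sigma> in auto)
  moreover have "(\<Sum>k. 2 * a k * \<sigma> k) = 2 * pi * \<eta> * M"
  proof -
    have "\<eta> * \<eta> = 1" using eta by (metis abs_1 abs_mult_self_eq mult_1)
    then have "\<eta> * (\<eta> * (\<Sum>k. 2 * a k * \<sigma> k)) = (\<Sum>k. 2 * a k * \<sigma> k)"
      by (simp add: mult.assoc[symmetric])
    then show ?thesis unfolding M_eq[symmetric] by (simp add: mult_ac)
  qed
  ultimately show ?thesis by simp
qed

lemma weighted_partial_sums: "(\<lambda>n. \<Sum>k<n. 2 * a k * (\<sigma> k * test_weight N k)) \<longlonglongrightarrow> (\<Sum>k. 2 * a k * \<sigma> k * test_weight N k)"
proof -
  have "summable (\<lambda>k. 2 * a k * \<sigma> k * test_weight N k)"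
    by (rule summable_finite[of "{..<N}"]) (auto simp: test_weight_def)
  from summable_LIMSEQ[OF this] show ?thesis by (simp only: mult.assoc)
qed

text \<open>The sine moments of the test kernel vanish and its cosine moments are the weights, so in
  the bilinear formula only \<open>\<sigma>\<close> remains, and the sum is finite.\<close>

lemma dual_test_1:
  "(\<integral>x. s x * (\<integral>t. test_kernel n t * K (x - t) \<partial>period_measure) \<partial>period_measure) = (\<Sum>k. 2 * a k * \<sigma> k * test_weight n k)"
  using bilinear_tendsto[OF periodic_L1D(3)[OF test_kernel_periodic_L1[of n]] periodic_L1D(3)[OF s_periodic_L1]]
    weighted_partial_sums[of n] unfolding test_kernel_moments \<sigma>_def[symmetric]
  by (simp add: LIMSEQ_unique)

lemma s_reflect: "periodic_L1 (\<lambda>t. s (- t))" "(\<integral>t. s (- t) \<partial>period_measure) = 0"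
proof -
  show "periodic_L1 (\<lambda>t. s (- t))"
  proof (rule periodic_L1I[OF borel_imp_lebesgue_measurable _ s_bounded])
    show "(\<lambda>t. s (- t)) \<in> borel_measurable borel" by (rule measurable_compose[OF _ s_borel]) simp
    show "s (- (t + 2 * pi)) = s (- t)" for t using periodic_L1D(2)[OF s_periodic_L1, of "- t - 2 * pi"] by simp
  qed
  show "(\<integral>t. s (- t) \<partial>period_measure) = 0"
    using periodic_L1_reflect(2)[OF s_periodic_L1, of 0] integral_s by simp
qed

text \<open>The reflected sign is chosen because its convolution integral at x = 0 is the integral
  of s K. An essential supremum does not see one point, so the test kernel averages near 0 and
  \<pi>. Expanding the phase on both sides leads to the same finite sum as for p = 1.\<close>

lemma dual_test_infinity:
  "(\<integral>x. test_kernel n x * (\<integral>t. s (- t) * K (x - t) \<partial>period_measure) \<partial>period_measure)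
    = (\<Sum>k. 2 * a k * \<sigma> k * test_weight n k)"
proof -
  note ti = periodic_L1D(3)[OF test_kernel_periodic_L1[of n]]
  note si = periodic_L1D(3)[OF s_periodic_L1]
  have \<theta>_moments: "(\<integral>x. test_kernel n x * cos (real (Suc k) * x - \<theta>) \<partial>period_measure) = cos \<theta> * test_weight n k"
    "(\<integral>x. test_kernel n x * sin (real (Suc k) * x - \<theta>) \<partial>period_measure) = - (sin \<theta> * test_weight n k)" for k
  proof -
    have "test_kernel n x * cos (real (Suc k) * x - \<theta>)
        = cos \<theta> * (test_kernel n x * cos (real (Suc k) * x)) + sin \<theta> * (test_kernel n x * sin (real (Suc k) * x))"
      "test_kernel n x * sin (real (Suc k) * x - \<theta>)
        = cos \<theta> * (test_kernel n x * sin (real (Suc k) * x)) - sin \<theta> * (test_kernel n x * cos (real (Suc k) * x))" for x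
      unfolding cos_diff sin_diff by (simp_all add: algebra_simps del: of_nat_Suc)
    then show "(\<integral>x. test_kernel n x * cos (real (Suc k) * x - \<theta>) \<partial>period_measure) = cos \<theta> * test_weight n k"
      "(\<integral>x. test_kernel n x * sin (real (Suc k) * x - \<theta>) \<partial>period_measure) = - (sin \<theta> * test_weight n k)"
      using integrable_mult_harmonic(3,4)[OF ti] test_kernel_moments(1,2)[of n k, unfolded cos_moment_def sin_moment_def]
      by (simp_all del: of_nat_Suc)
  qed
  have \<sigma>_eq: "\<sigma> k = cos \<theta> * cos_moment (\<lambda>t. s (- t)) (Suc k) - sin \<theta> * sin_moment (\<lambda>t. s (- t)) (Suc k)" for k
  proof -
    have "periodic_L1 (\<lambda>t. s t * cos (real (Suc k) * t))"
      using cos_harmonic_periodic[of "Suc k" _ 0]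
      by (intro periodic_L1_mult_bounded[OF s_periodic_L1, of _ 1] borel_imp_lebesgue_measurable
          borel_measurable_harmonic abs_cos_le_one) (simp del: of_nat_Suc)
    moreover have "periodic_L1 (\<lambda>t. s t * sin (real (Suc k) * t))"
      by (intro periodic_L1_mult_bounded[OF s_periodic_L1, of _ 1] borel_imp_lebesgue_measurable
          borel_measurable_harmonic abs_sin_le_one sin_harmonic_periodic)
    ultimately have "cos_moment (\<lambda>t. s (- t)) (Suc k) = (\<integral>t. s t * cos (real (Suc k) * t) \<partial>period_measure)"
      "sin_moment (\<lambda>t. s (- t)) (Suc k) = - (\<integral>t. s t * sin (real (Suc k) * t) \<partial>period_measure)"
      unfolding cos_moment_def sin_moment_def
      using periodic_L1_reflect(2)[of "\<lambda>t. s t * cos (real (Suc k) * t)" 0]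
        periodic_L1_reflect(2)[of "\<lambda>t. s t * sin (real (Suc k) * t)" 0] by (simp_all del: of_nat_Suc)
    moreover have "s t * cos (real (Suc k) * t - \<theta>)
        = cos \<theta> * (s t * cos (real (Suc k) * t)) + sin \<theta> * (s t * sin (real (Suc k) * t))" for t
      unfolding cos_diff by (simp add: algebra_simps del: of_nat_Suc)
    ultimately show ?thesis unfolding \<sigma>_def using integrable_mult_harmonic(3,4)[OF si] by (simp del: of_nat_Suc)
  qed
  have "cos \<theta> * test_weight n k * cos_moment (\<lambda>t. s (- t)) (Suc k)
      + - (sin \<theta> * test_weight n k) * sin_moment (\<lambda>t. s (- t)) (Suc k) = \<sigma> k * test_weight n k" for k
    unfolding \<sigma>_eq by (simp add: algebra_simps)
  then show ?thesis
    using bilinear_tendsto[OF periodic_L1D(3)[OF s_reflect(1)] ti] weighted_partial_sums[of n]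
    unfolding \<theta>_moments by (simp add: LIMSEQ_unique)
qed

text \<open>The sum is the pairing of the convolution with \<eta> s, a function bounded by
  1.\<close>

lemma test_sum_le_Lp_norm_1: "ereal (\<eta> * (\<Sum>k. 2 * a k * \<sigma> k * test_weight n k) / (2 * pi)) \<le> Lp_norm 1 (conv (test_kernel n) K)"
proof -
  let ?F = "conv (test_kernel n) K"
  note tp = test_kernel_periodic_L1[of n]
  have Fl: "?F \<in> borel_measurable lebesgue" by (rule borel_imp_lebesgue_measurable[OF conv_K_borel[OF tp]])
  have "\<bar>?F x\<bar> \<le> 1 / (2 * pi) * (C * (\<integral>t. \<bar>test_kernel n t\<bar> \<partial>period_measure))" for x
    unfolding conv_K[OF tp] abs_mult using K_conv_bounded[OF periodic_L1D(3)[OF tp]]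
    by (intro mult_mono) auto
  then have Fi: "integrable period_measure ?F" by (rule integrable_period_bounded[OF Fl])
  have "\<eta> * (\<Sum>k. 2 * a k * \<sigma> k * test_weight n k) / (2 * pi) = (\<integral>x. \<eta> * s x * ?F x \<partial>period_measure)"
    unfolding dual_test_1[symmetric] conv_K[OF tp] by (simp add: mult.assoc mult.left_commute[of "s _"])
  also have "\<dots> \<le> (\<integral>x. \<bar>?F x\<bar> \<partial>period_measure)"
  proof (rule integral_mono)
    have "integrable period_measure (\<lambda>x. ?F x * s x)"
      by (rule integrable_mult_bounded[OF Fi borel_imp_lebesgue_measurable[OF s_borel] s_bounded])
    then have "integrable period_measure (\<lambda>x. \<eta> * (?F x * s x))" by simp
    then show "integrable period_measure (\<lambda>x. \<eta> * s x * ?F x)" by (simp only: mult_ac)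
    show "\<eta> * s x * ?F x \<le> \<bar>?F x\<bar>" for x
    proof -
      have "\<bar>\<eta> * s x * ?F x\<bar> = \<bar>s x\<bar> * \<bar>?F x\<bar>" using eta by (simp add: abs_mult)
      also have "\<dots> \<le> \<bar>?F x\<bar>" using s_bounded[of x] by (intro mult_left_le_one_le) auto
      finally show ?thesis by linarith
    qed
  qed (use Fi in simp)
  finally show ?thesis unfolding Lp_norm_1(1)[OF Fl Fi] by simp
qed

lemma test_sum_le_Lp_norm_infinity:
  "ereal (\<eta> * (\<Sum>k. 2 * a k * \<sigma> k * test_weight n k) / (2 * pi)) \<le> Lp_norm \<infinity> (conv (\<lambda>t. s (- t)) K)"
proof (rule ereal_le_real)
  let ?F = "conv (\<lambda>t. s (- t)) K"
  have Fl: "?F \<in> borel_measurable lebesgue" by (rule borel_imp_lebesgue_measurable[OF conv_K_borel[OF s_reflect(1)]])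
  fix N :: real assume "Lp_norm \<infinity> ?F \<le> ereal N"
  then have AE: "AE x in period_measure. \<bar>?F x\<bar> \<le> N" using Lp_norm_infinity_le_iff[OF Fl] by simp
  note ti = periodic_L1D(3)[OF test_kernel_periodic_L1[of n]]
  have tF: "integrable period_measure (\<lambda>x. test_kernel n x * ?F x)"
    unfolding conv_K[OF s_reflect(1)]
  proof (rule integrable_mult_bounded[OF ti])
    show "(\<lambda>x. 1 / (2 * pi) * (\<integral>t. s (- t) * K (x - t) \<partial>period_measure)) \<in> borel_measurable lebesgue"
      using Fl unfolding conv_K[OF s_reflect(1), abs_def] .
    show "\<bar>1 / (2 * pi) * (\<integral>t. s (- t) * K (x - t) \<partial>period_measure)\<bar>
        \<le> 1 / (2 * pi) * (C * (\<integral>t. \<bar>s (- t)\<bar> \<partial>period_measure))" for x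
      unfolding abs_mult using K_conv_bounded[OF periodic_L1D(3)[OF s_reflect(1)]] by (intro mult_mono) auto
  qed
  \<comment> \<open>A negative N would bound a modulus almost everywhere on a set of positive
    measure. Nonnegativity is required to multiply the bound on the L1 norm of the test kernel by
    N.\<close>
  have N: "0 \<le> N"
  proof (rule ccontr)
    assume "\<not> 0 \<le> N"
    with AE have "AE x in period_measure. False" by (auto elim!: eventually_mono)
    then have "emeasure period_measure (space period_measure) = 0"
      unfolding eventually_False ae_filter_eq_bot_iff .
    then show False unfolding emeasure_period_measure by simp
  qed
  have "\<eta> * (\<Sum>k. 2 * a k * \<sigma> k * test_weight n k) / (2 * pi) = (\<integral>x. \<eta> * (test_kernel n x * ?F x) \<partial>period_measure)"
    unfolding dual_test_infinity[symmetric] conv_K[OF s_reflect(1)] by (simp add: mult.left_commute[of "test_kernel _ _"])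
  also have "\<dots> \<le> (\<integral>x. N * \<bar>test_kernel n x\<bar> \<partial>period_measure)"
  proof (rule integral_mono_AE)
    show "AE x in period_measure. \<eta> * (test_kernel n x * ?F x) \<le> N * \<bar>test_kernel n x\<bar>"
      using AE
    proof eventually_elim
      case (elim x)
      have "\<bar>\<eta> * (test_kernel n x * ?F x)\<bar> = \<bar>?F x\<bar> * \<bar>test_kernel n x\<bar>" using eta by (simp add: abs_mult)
      also have "\<dots> \<le> N * \<bar>test_kernel n x\<bar>" using elim by (rule mult_right_mono) simp
      finally show ?case by linarith
    qed
  qed (use tF ti in simp_all)
  also have "\<dots> \<le> N * 1" using mult_left_mono[OF integral_abs_test_kernel N] by simp
  finally show "ereal (\<eta> * (\<Sum>k. 2 * a k * \<sigma> k * test_weight n k) / (2 * pi)) \<le> ereal N" by simp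
qed

text \<open>The lower bound is a limit over n. For p = 1 the test function itself varies with n; for
  p = \<infinity> it is fixed and only the function paired with its convolution varies.\<close>

theorem SUP_Lp_norm_conv_K:
  assumes p: "p \<in> {1, \<infinity>}"
  shows "(SUP f\<in>H1 p. Lp_norm p (conv f K)) = ereal M"
proof (rule antisym)
  show "(SUP f\<in>H1 p. Lp_norm p (conv f K)) \<le> ereal M"
  proof (rule SUP_least)
    fix f assume "f \<in> H1 p"
    note f = H1_D[OF this p]
    have Fl: "conv f K \<in> borel_measurable lebesgue" by (rule borel_imp_lebesgue_measurable[OF conv_K_borel[OF f(1)]])
    show "Lp_norm p (conv f K) \<le> ereal M"
    proof (cases "p = 1")
      case True
      have "\<bar>conv f K x\<bar> \<le> 1 / (2 * pi) * (C * (\<integral>t. \<bar>f t\<bar> \<partial>period_measure))" for x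
        unfolding conv_K[OF f(1)] abs_mult using K_conv_bounded[OF periodic_L1D(3)[OF f(1)]]
        by (intro mult_mono) auto
      then have Fi: "integrable period_measure (conv f K)" by (rule integrable_period_bounded[OF Fl])
      show ?thesis unfolding True Lp_norm_1(1)[OF Fl Fi] using conv_K_bound_1[OF f(1,2) f(3)[OF True]] by simp
    next
      case False
      then have "p = \<infinity>" using p by simp
      then show ?thesis using conv_K_bound_infinity[OF f(1,2) f(4)] Lp_norm_infinity_le_iff[OF Fl] by simp
    qed
  qed
  have "ereal (\<eta> * (\<Sum>k. 2 * a k * \<sigma> k * test_weight n k) / (2 * pi)) \<le> (SUP f\<in>H1 p. Lp_norm p (conv f K))" for n
  proof (cases "p = 1")
    case True
    have "test_kernel n \<in> H1 1"
      using H1_I[OF test_kernel_periodic_L1 test_kernel_moments(3)] integral_abs_test_kernel by blast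
    then show ?thesis unfolding True by (rule SUP_upper2) (rule test_sum_le_Lp_norm_1)
  next
    case False
    then have "p = \<infinity>" using p by simp
    moreover have "(\<lambda>t. s (- t)) \<in> H1 \<infinity>" using H1_I[OF s_reflect] s_bounded by blast
    ultimately show ?thesis using test_sum_le_Lp_norm_infinity by (auto intro: SUP_upper2)
  qed
  then have upper: "\<exists>N. \<forall>n\<ge>N. ereal (\<eta> * (\<Sum>k. 2 * a k * \<sigma> k * test_weight n k) / (2 * pi)) \<le> (SUP f\<in>H1 p. Lp_norm p (conv f K))"
    by blast
  have "(\<lambda>n. ereal (\<eta> * (\<Sum>k. 2 * a k * \<sigma> k * test_weight n k) / (2 * pi))) \<longlonglongrightarrow> ereal M"
  proof -
    have "\<eta> * \<eta> = 1" using eta by (metis abs_1 abs_mult_self_eq mult_1)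
    then have eq: "\<eta> * (2 * pi * \<eta> * M) / (2 * pi) = M" by simp
    have "(\<lambda>n. \<eta> * (\<Sum>k. 2 * a k * \<sigma> k * test_weight n k) / (2 * pi)) \<longlonglongrightarrow> \<eta> * (2 * pi * \<eta> * M) / (2 * pi)"
      by (intro tendsto_intros test_sum_tendsto) simp
    then show ?thesis unfolding eq by simp
  qed
  from LIMSEQ_le_const2[OF this upper] show "ereal M \<le> (SUP f\<in>H1 p. Lp_norm p (conv f K))" .
qed

end

subsection \<open>Sine and cosine kernels\<close>

lemma sum_sin_bounded:
  assumes "sin (t / 2) \<noteq> 0"
  shows "\<bar>\<Sum>k<n. sin (real (Suc k) * t)\<bar> \<le> 1 / \<bar>sin (t / 2)\<bar>"
proof -
  have "\<bar>2 * sin (t / 2) * (\<Sum>k<n. sin (real (Suc k) * t))\<bar> \<le> 2"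
    unfolding two_sin_half_sum_sin
    using abs_cos_le_one[of "t / 2"] abs_cos_le_one[of "(real n + 1 / 2) * t"] by linarith
  then show ?thesis using assms by (simp add: abs_mult field_simps)
qed

lemma sum_cos_bounded:
  assumes "sin (t / 2) \<noteq> 0"
  shows "\<bar>\<Sum>k<n. cos (real (Suc k) * t)\<bar> \<le> 1 / \<bar>sin (t / 2)\<bar>"
proof -
  have "\<bar>2 * sin (t / 2) * (\<Sum>k<n. cos (real (Suc k) * t))\<bar> \<le> 2"
    unfolding two_sin_half_sum_cos
    using abs_sin_le_one[of "t / 2"] abs_sin_le_one[of "(real n + 1 / 2) * t"] by linarith
  then show ?thesis using assms by (simp add: abs_mult field_simps)
qed

text \<open>All terms vanish where sin(t/2) = 0; elsewhere the sums of sines are bounded and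
  Dirichlet's test applies.\<close>

lemma summable_sin_sum: "summable (\<lambda>k. sin (real (Suc k) * t) / real (Suc k))"
proof (cases "sin (t / 2) = 0")
  case True
  then obtain j :: int where "t / 2 = real_of_int j * pi" using sin_zero_iff_int2 by blast
  then have "real (Suc k) * t = real_of_int (2 * int (Suc k) * j) * pi" for k by (simp add: algebra_simps)
  then have "sin (real (Suc k) * t) = 0" for k by (metis sin_zero_iff_int2)
  then show ?thesis by (simp del: of_nat_Suc)
next
  case False
  have "summable (\<lambda>k. 1 / real (Suc k) * sin (real (Suc k) * t))"
  proof (rule abel_convergent)
    show "decseq (\<lambda>k. 1 / real (Suc k))" by (auto intro!: decseq_SucI divide_left_mono)
    show "(\<lambda>k. 1 / real (Suc k)) \<longlonglongrightarrow> 0 \<or> summable (\<lambda>k. sin (real (Suc k) * t))"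
      using LIMSEQ_inverse_real_of_nat by (simp add: inverse_eq_divide)
  qed (use sum_sin_bounded[OF False] in auto)
  then show ?thesis by simp
qed

text \<open>The weight \<open>d k\<close> stands for k + 1 times the coefficient, so that summation
  by parts meets the sums of the Fejer-Jackson inequality. In \<open>cos_kernel\<close> the power is
  2, because there it is the derivative that has to be of this form.\<close>

definition sin_kernel :: "(nat \<Rightarrow> real) \<Rightarrow> real \<Rightarrow> real" where
  "sin_kernel d t = (\<Sum>k. d k * (sin (real (Suc k) * t) / real (Suc k)))"

definition cos_kernel :: "(nat \<Rightarrow> real) \<Rightarrow> real \<Rightarrow> real" where
  "cos_kernel d t = (\<Sum>k. d k * (cos (real (Suc k) * t) / (real (Suc k))\<^sup>2))"

context
  fixes d :: "nat \<Rightarrow> real"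
  assumes d: "decseq d" "\<And>k. 0 \<le> d k"
begin

lemma d_le: "d k \<le> d 0"
  using d(1) by (simp add: decseq_def)

lemma sin_kernel_sums: "(\<lambda>n. \<Sum>k<n. d k * (sin (real (Suc k) * t) / real (Suc k))) \<longlonglongrightarrow> sin_kernel d t"
proof -
  have "summable (\<lambda>k. d k * (sin (real (Suc k) * t) / real (Suc k)))"
    using sin_sum_bounded summable_sin_sum unfolding sin_sum_def by (intro abel_convergent[OF d]) blast+
  from summable_LIMSEQ[OF this] show ?thesis unfolding sin_kernel_def .
qed

lemma sin_kernel_nonneg: "0 \<le> t \<Longrightarrow> t \<le> pi \<Longrightarrow> 0 \<le> sin_kernel d t"
  using abel_nonneg[OF d, of "\<lambda>k. sin (real (Suc k) * t) / real (Suc k)"] fejer_jackson[of t]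
  unfolding sin_sum_def by (intro LIMSEQ_le_const[OF sin_kernel_sums]) blast

lemma sin_kernel_minus: "sin_kernel d (- t) = - sin_kernel d t"
  using tendsto_minus[OF sin_kernel_sums[of t]] sin_kernel_sums[of "- t"]
  by (simp add: sum_negf LIMSEQ_unique)

lemma sin_kernel_periodic: "sin_kernel d (t + 2 * pi) = sin_kernel d t"
  unfolding sin_kernel_def sin_harmonic_periodic ..

lemma sin_kernel_sign: "sin_kernel d t * sgn (sin t) = \<bar>sin_kernel d t\<bar>"
proof -
  have nonneg: "sin_kernel d u * sgn (sin u) = \<bar>sin_kernel d u\<bar>" if u: "0 \<le> u" "u \<le> pi" for u
  proof (cases "u = 0 \<or> u = pi")
    \<comment> \<open>At the endpoints the sign factor is 0, so the kernel itself has to vanish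
      there.\<close>
    case True
    have "sin (real (Suc k) * u) = 0" for k using True sin_harmonic_pi[of "Suc k"] by auto
    then have "sin_kernel d u = 0" unfolding sin_kernel_def by (simp del: of_nat_Suc)
    then show ?thesis by simp
  next
    case False
    then have "0 < sin u" using u by (intro sin_gt_zero) auto
    then show ?thesis using sin_kernel_nonneg[OF u] by simp
  qed
  obtain j where j: "t + 2 * pi * real_of_int j \<in> {-pi..pi}" using ex_int_shift_period .
  define u where "u = t + 2 * pi * real_of_int j"
  have u: "- pi \<le> u" "u \<le> pi" using j unfolding u_def by auto
  have "sin_kernel d u * sgn (sin u) = \<bar>sin_kernel d u\<bar>"
  proof (cases "0 \<le> u")
    case False
    then show ?thesis using nonneg[of "- u"] u sin_kernel_minus[of u] by (simp add: sgn_minus)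
  qed (use nonneg u in blast)
  moreover have "sin_kernel d u = sin_kernel d t" "sin u = sin t"
    unfolding u_def using periodic_int_shift[of "sin_kernel d" t j] sin_kernel_periodic
      periodic_int_shift[of sin t j] by simp_all
  ultimately show ?thesis by simp
qed

text \<open>With cos \<theta> = 0 the harmonic cos(kt - \<theta>) reduces to sin \<theta> sin(kt).
  The bound is the sawtooth bound \<pi> + 1 times the first weight, doubled by the 2 in
  \<open>trig_sum\<close>.\<close>

lemma bounded_series_sin:
  assumes \<theta>: "cos \<theta> = 0"
  shows "bounded_series (\<lambda>k. d k / real (Suc k)) \<theta> (2 * ((pi + 1) * d 0)) (\<lambda>t. 2 * sin \<theta> * sin_kernel d t)"
proof
  have *: "trig_sum (\<lambda>k. d k / real (Suc k)) \<theta> n t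
      = 2 * sin \<theta> * (\<Sum>k<n. d k * (sin (real (Suc k) * t) / real (Suc k)))" for n t
    unfolding trig_sum_def cos_diff \<theta> sum_distrib_left by (intro sum.cong refl) simp
  show "(\<lambda>n. trig_sum (\<lambda>k. d k / real (Suc k)) \<theta> n t) \<longlonglongrightarrow> 2 * sin \<theta> * sin_kernel d t" for t
    unfolding * by (intro tendsto_mult tendsto_const sin_kernel_sums)
  show "\<bar>trig_sum (\<lambda>k. d k / real (Suc k)) \<theta> n t\<bar> \<le> 2 * ((pi + 1) * d 0)" for n t
  proof -
    have "\<bar>\<Sum>k<n. d k * (sin (real (Suc k) * t) / real (Suc k))\<bar> \<le> (pi + 1) * d 0"
      using sin_sum_bounded unfolding sin_sum_def by (rule abel_bounded[OF d])
    then have "\<bar>2 * sin \<theta>\<bar> * \<bar>\<Sum>k<n. d k * (sin (real (Suc k) * t) / real (Suc k))\<bar> \<le> 2 * ((pi + 1) * d 0)"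
      by (intro mult_mono) (auto simp: abs_mult)
    then show ?thesis unfolding * abs_mult by simp
  qed
qed

lemma summable_cos_kernel: "summable (\<lambda>k. d k * (1 / (real (Suc k))\<^sup>2))"
proof (rule summable_comparison_test)
  show "summable (\<lambda>k. d 0 * (1 / (real k + 1)\<^sup>2))"
    using sums_summable[OF inverse_squares_sums] by (intro summable_mult) (simp add: add.commute)
  show "\<exists>N. \<forall>k\<ge>N. norm (d k * (1 / (real (Suc k))\<^sup>2)) \<le> d 0 * (1 / (real k + 1)\<^sup>2)"
    using d(2) d_le by (auto intro!: exI[of _ 0] divide_right_mono simp: add.commute)
qed

lemma abs_cos_term_le: "\<bar>d k * (cos (real (Suc k) * t) / (real (Suc k))\<^sup>2)\<bar> \<le> d k * (1 / (real (Suc k))\<^sup>2)"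
  unfolding abs_mult abs_divide using d(2)[of k] by (intro mult_mono divide_mono) auto

lemma cos_kernel_sums: "(\<lambda>n. \<Sum>k<n. d k * (cos (real (Suc k) * t) / (real (Suc k))\<^sup>2)) \<longlonglongrightarrow> cos_kernel d t"
proof -
  have "summable (\<lambda>k. d k * (cos (real (Suc k) * t) / (real (Suc k))\<^sup>2))"
    by (rule summable_comparison_test'[OF summable_cos_kernel, of 0]) (simp only: real_norm_def abs_cos_term_le)
  from summable_LIMSEQ[OF this] show ?thesis unfolding cos_kernel_def .
qed

lemma cos_kernel_minus: "cos_kernel d (- t) = cos_kernel d t"
  unfolding cos_kernel_def by simp

lemma cos_kernel_periodic: "cos_kernel d (t + 2 * pi) = cos_kernel d t"
  unfolding cos_kernel_def using cos_harmonic_periodic[where \<theta> = 0] by (simp del: of_nat_Suc)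

text \<open>Only partial sums are differentiated: their derivatives are minus weighted Fejer-Jackson
  sums, and the weak inequality passes to the limit.\<close>

lemma cos_kernel_antimono:
  assumes st: "0 \<le> u" "u \<le> v" "v \<le> pi"
  shows "cos_kernel d v \<le> cos_kernel d u"
proof (rule LIMSEQ_le[OF cos_kernel_sums cos_kernel_sums], intro exI allI impI)
  fix n :: nat
  let ?P = "\<lambda>t. \<Sum>k<n. d k * (cos (real (Suc k) * t) / (real (Suc k))\<^sup>2)"
  have deriv: "(?P has_real_derivative - (\<Sum>k<n. d k * (sin (real (Suc k) * t) / real (Suc k)))) (at t)" for t
  proof -
    have "((\<lambda>t. d k * (cos (real (Suc k) * t) / (real (Suc k))\<^sup>2)) has_real_derivative
        - (d k * (sin (real (Suc k) * t) / real (Suc k)))) (at t)" for k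
      by (auto intro!: derivative_eq_intros simp: power2_eq_square simp del: of_nat_Suc)
    then show ?thesis unfolding sum_negf[symmetric] by (intro DERIV_sum)
  qed
  show "?P v \<le> ?P u"
  proof (rule DERIV_nonpos_imp_nonincreasing[OF st(2)])
    fix t assume "u \<le> t" "t \<le> v"
    then have "0 \<le> (\<Sum>k<n. d k * (sin (real (Suc k) * t) / real (Suc k)))"
      using st fejer_jackson[of t] unfolding sin_sum_def by (intro abel_nonneg[OF d]) auto
    then show "\<exists>y. (?P has_real_derivative y) (at t) \<and> y \<le> 0" using deriv by (intro exI conjI) auto
  qed
qed

text \<open>Evenness and periodicity fold t into [0, \<pi>]. There both cos and the kernel decrease,
  and subtracting the value at \<pi>/2 places the sign change of the kernel at the zero of
  cos.\<close>

lemma cos_kernel_sign: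
  "(cos_kernel d t - cos_kernel d (pi / 2)) * sgn (cos t) = \<bar>cos_kernel d t - cos_kernel d (pi / 2)\<bar>"
proof -
  obtain j where j: "t + 2 * pi * real_of_int j \<in> {-pi..pi}" using ex_int_shift_period .
  define u where "u = \<bar>t + 2 * pi * real_of_int j\<bar>"
  have u: "0 \<le> u" "u \<le> pi" using j unfolding u_def by auto
  have "cos_kernel d u = cos_kernel d (t + 2 * pi * real_of_int j)" "cos u = cos (t + 2 * pi * real_of_int j)"
    unfolding u_def using cos_kernel_minus[of "t + 2 * pi * real_of_int j"]
      cos_minus[of "t + 2 * pi * real_of_int j"] by (auto simp only: abs_if split: if_splits)
  then have eq: "cos_kernel d t = cos_kernel d u" "cos t = cos u"
    using periodic_int_shift[of "cos_kernel d" t j] cos_kernel_periodic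
      periodic_int_shift[of cos t j] by simp_all
  consider "u < pi / 2" | "u = pi / 2" | "pi / 2 < u" by linarith
  then show ?thesis unfolding eq
  proof cases
    case 1
    then have "0 < cos u" using u by (intro cos_gt_zero_pi) auto
    then show "(cos_kernel d u - cos_kernel d (pi / 2)) * sgn (cos u) = \<bar>cos_kernel d u - cos_kernel d (pi / 2)\<bar>"
      using cos_kernel_antimono[of u "pi / 2"] u 1 by simp
  next
    case 2
    show "(cos_kernel d u - cos_kernel d (pi / 2)) * sgn (cos u) = \<bar>cos_kernel d u - cos_kernel d (pi / 2)\<bar>"
      unfolding 2 by simp
  next
    case 3
    then have "0 < cos (pi - u)" using u by (intro cos_gt_zero_pi) auto
    then have "cos u < 0" by simp
    then show "(cos_kernel d u - cos_kernel d (pi / 2)) * sgn (cos u) = \<bar>cos_kernel d u - cos_kernel d (pi / 2)\<bar>"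
      using cos_kernel_antimono[of "pi / 2" u] u 3 by simp
  qed
qed

text \<open>As sin \<theta> = 0, only cos \<theta> cos(kt) remains of each harmonic, and the inverse
  squares make the series converge absolutely; the bound is the sum of the majorants,
  doubled.\<close>

lemma bounded_series_cos:
  assumes \<theta>: "sin \<theta> = 0"
  shows "bounded_series (\<lambda>k. d k / (real (Suc k))\<^sup>2) \<theta> (2 * (\<Sum>k. d k * (1 / (real (Suc k))\<^sup>2)))
    (\<lambda>t. 2 * cos \<theta> * cos_kernel d t)"
proof
  have *: "trig_sum (\<lambda>k. d k / (real (Suc k))\<^sup>2) \<theta> n t
      = 2 * cos \<theta> * (\<Sum>k<n. d k * (cos (real (Suc k) * t) / (real (Suc k))\<^sup>2))" for n t
    unfolding trig_sum_def cos_diff \<theta> sum_distrib_left by (intro sum.cong refl) simp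
  show "(\<lambda>n. trig_sum (\<lambda>k. d k / (real (Suc k))\<^sup>2) \<theta> n t) \<longlonglongrightarrow> 2 * cos \<theta> * cos_kernel d t" for t
    unfolding * by (intro tendsto_mult tendsto_const cos_kernel_sums)
  show "\<bar>trig_sum (\<lambda>k. d k / (real (Suc k))\<^sup>2) \<theta> n t\<bar> \<le> 2 * (\<Sum>k. d k * (1 / (real (Suc k))\<^sup>2))" for n t
  proof -
    have "\<bar>\<Sum>k<n. d k * (cos (real (Suc k) * t) / (real (Suc k))\<^sup>2)\<bar> \<le> (\<Sum>k<n. d k * (1 / (real (Suc k))\<^sup>2))"
      by (rule sum_abs[THEN order_trans], rule sum_mono, rule abs_cos_term_le)
    also have "\<dots> \<le> (\<Sum>k. d k * (1 / (real (Suc k))\<^sup>2))"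
      using d(2) by (intro sum_le_suminf summable_cos_kernel) auto
    finally have "\<bar>2 * cos \<theta>\<bar> * \<bar>\<Sum>k<n. d k * (cos (real (Suc k) * t) / (real (Suc k))\<^sup>2)\<bar>
        \<le> 2 * (\<Sum>k. d k * (1 / (real (Suc k))\<^sup>2))"
      by (intro mult_mono) (auto simp: abs_mult)
    then show ?thesis unfolding * abs_mult by simp
  qed
qed

end

section \<open>Moments of the square waves\<close>

lemma has_integral_sin_harmonic:
  assumes "a \<le> b"
  shows "((\<lambda>t. sin (real (Suc k) * t)) has_integral (cos (real (Suc k) * a) - cos (real (Suc k) * b)) / real (Suc k)) {a..b}"
proof -
  have "((\<lambda>t. - cos (real (Suc k) * t) / real (Suc k)) has_real_derivative sin (real (Suc k) * t)) (at t)" for t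
    by (auto intro!: derivative_eq_intros simp del: of_nat_Suc)
  then have "((\<lambda>t. sin (real (Suc k) * t)) has_integral
      (- cos (real (Suc k) * b) / real (Suc k) - (- cos (real (Suc k) * a) / real (Suc k)))) {a..b}"
    by (intro fundamental_theorem_of_calculus[OF assms])
      (auto simp: has_real_derivative_iff_has_vector_derivative[symmetric] intro: has_field_derivative_at_within)
  then show ?thesis by (simp add: diff_divide_distrib del: of_nat_Suc)
qed

lemma sgn_sin_borel: "(\<lambda>t::real. sgn (sin t)) \<in> borel_measurable borel"
  by (intro measurable_compose[OF _ borel_measurable_sgn] borel_measurable_continuous_onI continuous_intros)

lemma sgn_cos_borel: "(\<lambda>t::real. sgn (cos t)) \<in> borel_measurable borel"
  by (intro measurable_compose[OF _ borel_measurable_sgn] borel_measurable_continuous_onI continuous_intros)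

lemma integral_sgn_sin: 
  "(\<integral>t. sgn (sin t) * sin (real (Suc k) * t) \<partial>period_measure) = (if even k then 4 / real (Suc k) else 0)"
proof -
  let ?f = "\<lambda>t::real. sgn (sin t) * sin (real (Suc k) * t)"
  have "(?f has_integral (1 - cos (real (Suc k) * pi)) / real (Suc k)) (cbox 0 pi)"
    by (rule has_integral_spike_interior[where f = "\<lambda>t. sin (real (Suc k) * t)"])
      (use has_integral_sin_harmonic[of 0 pi k] in \<open>auto simp: sin_gt_zero simp del: of_nat_Suc\<close>)
  moreover have "(?f has_integral (1 - cos (real (Suc k) * pi)) / real (Suc k)) (cbox (- pi) 0)"
  proof (rule has_integral_spike_interior[where f = "\<lambda>t. - sin (real (Suc k) * t)"])
    show "((\<lambda>t. - sin (real (Suc k) * t)) has_integral (1 - cos (real (Suc k) * pi)) / real (Suc k)) (cbox (- pi) 0)"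
      using has_integral_neg[OF has_integral_sin_harmonic[of "- pi" 0 k]]
      by (simp add: minus_divide_left del: of_nat_Suc)
    show "?f t = - sin (real (Suc k) * t)" if "t \<in> box (- pi) 0" for t
      using that sin_gt_zero[of "- t"] by (simp del: of_nat_Suc)
  qed
  ultimately have "(?f has_integral
      ((1 - cos (real (Suc k) * pi)) / real (Suc k) + (1 - cos (real (Suc k) * pi)) / real (Suc k))) {-pi..pi}"
    by (intro has_integral_combine[of "- pi" 0 pi]) auto
  moreover have "integrable period_measure ?f"
  proof (rule integrable_period_bounded[where C = 1])
    show "?f \<in> borel_measurable lebesgue"
      by (intro borel_imp_lebesgue_measurable borel_measurable_times sgn_sin_borel borel_measurable_harmonic)
    show "\<bar>?f t\<bar> \<le> 1" for t by (auto simp: abs_mult abs_sgn_eq simp del: of_nat_Suc)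
  qed
  ultimately have "(\<integral>t. ?f t \<partial>period_measure)
      = (1 - cos (real (Suc k) * pi)) / real (Suc k) + (1 - cos (real (Suc k) * pi)) / real (Suc k)"
    by (simp add: lebesgue_integral_eq_integral integral_unique)
  also have "cos (real (Suc k) * pi) = (-1) ^ Suc k" by (rule cos_npi)
  finally show ?thesis by (simp split: if_splits)
qed

text \<open>Translation by \<pi>/2 reduces it to the sine case; the mixed term is odd and integrates
  to 0. The alternating sign is sin((k + 1) \<pi>/2) for even k.\<close>

lemma integral_sgn_cos:
  "(\<integral>t. sgn (cos t) * cos (real (Suc k) * t) \<partial>period_measure)
    = (if even k then 4 / real (Suc k) * (-1) ^ (k div 2) else 0)"
proof -
  let ?f = "\<lambda>t::real. sgn (cos t) * cos (real (Suc k) * t)"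
  let ?g = "\<lambda>t::real. sgn (sin t) * cos (real (Suc k) * t)"
  have bound: "\<bar>sgn u * cos v\<bar> \<le> 1" for u v :: real by (auto simp: abs_mult abs_sgn_eq)
  have cper: "cos (real (Suc k) * (t + 2 * pi)) = cos (real (Suc k) * t)" for t
    using cos_harmonic_periodic[of "Suc k" t 0] by (simp del: of_nat_Suc)
  have "periodic_L1 ?f"
  proof (rule periodic_L1I[OF _ _ bound])
    show "?f \<in> borel_measurable lebesgue"
      by (intro borel_imp_lebesgue_measurable borel_measurable_times sgn_cos_borel borel_measurable_harmonic)
    show "?f (t + 2 * pi) = ?f t" for t unfolding cper by simp
  qed
  from periodic_L1_translate[OF this, of "- (pi / 2)"]
  have "(\<integral>t. ?f t \<partial>period_measure) = (\<integral>t. sgn (cos (t - pi / 2)) * cos (real (Suc k) * (t - pi / 2)) \<partial>period_measure)"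
    by simp
  also have "\<dots> = (\<integral>t. cos (real (Suc k) * (pi / 2)) * ?g t
      + sin (real (Suc k) * (pi / 2)) * (sgn (sin t) * sin (real (Suc k) * t)) \<partial>period_measure)"
    by (intro Bochner_Integration.integral_cong refl)
      (simp add: right_diff_distrib cos_diff algebra_simps del: of_nat_Suc)
  also have "\<dots> = cos (real (Suc k) * (pi / 2)) * (\<integral>t. ?g t \<partial>period_measure)
      + sin (real (Suc k) * (pi / 2)) * (\<integral>t. sgn (sin t) * sin (real (Suc k) * t) \<partial>period_measure)"
  proof -
    have "integrable period_measure (\<lambda>t. sgn (sin t))"
      by (rule integrable_period_bounded[where C = 1, OF borel_imp_lebesgue_measurable[OF sgn_sin_borel]])
        (simp add: abs_sgn_eq)
    from integrable_mult_harmonic(3,4)[OF this] show ?thesis by (simp del: of_nat_Suc)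
  qed
  also have "(\<integral>t. ?g t \<partial>period_measure) = 0"
  proof -
    have "periodic_L1 ?g"
    proof (rule periodic_L1I[OF _ _ bound])
      show "?g \<in> borel_measurable lebesgue"
        by (intro borel_imp_lebesgue_measurable borel_measurable_times sgn_sin_borel borel_measurable_harmonic)
      show "?g (t + 2 * pi) = ?g t" for t unfolding cper by simp
    qed
    from periodic_L1_reflect(2)[OF this, of 0] show ?thesis by (simp add: sgn_minus del: of_nat_Suc)
  qed
  finally have "(\<integral>t. ?f t \<partial>period_measure)
      = sin (real (Suc k) * (pi / 2)) * (if even k then 4 / real (Suc k) else 0)"
    unfolding integral_sgn_sin by simp
  moreover have "sin (real (Suc k) * (pi / 2)) = (-1) ^ (k div 2)" if "even k"
  proof -
    obtain j where j: "k = 2 * j" using \<open>even k\<close> by (rule evenE)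
    have "sin (real (Suc k) * (pi / 2)) = sin (real j * pi + pi / 2)" unfolding j by (simp add: algebra_simps)
    then show ?thesis unfolding j sin_add by (simp add: cos_npi)
  qed
  ultimately show ?thesis by auto
qed

lemma suminf_even_terms:
  fixes f :: "nat \<Rightarrow> real"
  assumes f: "summable f" and zero: "\<And>k. odd k \<Longrightarrow> f k = 0"
  shows "summable (\<lambda>j. f (2 * j))" "(\<Sum>k. f k) = (\<Sum>j. f (2 * j))"
proof -
  have "strict_mono (\<lambda>j::nat. 2 * j)" by (simp add: strict_mono_def)
  moreover have "f k = 0" if "k \<notin> range (\<lambda>j. 2 * j)" for k using that zero[of k] by (auto elim: evenE)
  ultimately show "summable (\<lambda>j. f (2 * j))" "(\<Sum>k. f k) = (\<Sum>j. f (2 * j))"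
    using summable_mono_reindex[of "\<lambda>j. 2 * j" f] suminf_mono_reindex[of "\<lambda>j. 2 * j" f] f by auto
qed

text \<open>The extremal sign is sgn sin, with c = 0 and \<eta> = sin \<theta>. As \<eta> enters
  both in the kernel and in its sign, it is squared away, and 2 \<pi> M = 2 * 4 times the sum gives
  4/\<pi>.\<close>

lemma extremal_sin:
  assumes d: "decseq d" "\<And>k. 0 \<le> d k" and \<theta>: "cos \<theta> = 0" and p: "p \<in> {1, \<infinity>}"
  shows "summable (\<lambda>j. d (2 * j) / (real (Suc (2 * j)))\<^sup>2)"
    and "(SUP f\<in>H1 p. Lp_norm p (conv f (\<lambda>t. 2 * sin \<theta> * sin_kernel d t)))
      = ereal (4 / pi * (\<Sum>j. d (2 * j) / (real (Suc (2 * j)))\<^sup>2))"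
proof -
  let ?a = "\<lambda>k. d k / real (Suc k)"
  let ?J = "\<lambda>k. if even k then 4 / real (Suc k) else 0 :: real"
  interpret S: bounded_series ?a \<theta> "2 * ((pi + 1) * d 0)" "\<lambda>t. 2 * sin \<theta> * sin_kernel d t"
    by (rule bounded_series_sin[OF d \<theta>])
  have ss: "sin \<theta> * sin \<theta> = 1" using sin_cos_squared_add[of \<theta>] \<theta> by (simp add: power2_eq_square)
  have moments: "(\<integral>t. sgn (sin t) * cos (real (Suc k) * t - \<theta>) \<partial>period_measure) = sin \<theta> * ?J k" for k
  proof -
    have *: "sgn (sin t) * cos (real (Suc k) * t - \<theta>) = sin \<theta> * (sgn (sin t) * sin (real (Suc k) * t))" for t :: real
      unfolding cos_diff \<theta> by simp
    show ?thesis unfolding * integral_sgn_sin[symmetric] by simp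
  qed
  have abs_summable: "summable (\<lambda>k. \<bar>?a k * ?J k\<bar>)"
  proof (rule summable_comparison_test'[of _ 0])
    show "summable (\<lambda>k. 4 * (d k * (1 / (real (Suc k))\<^sup>2)))" by (intro summable_mult summable_cos_kernel d)
    show "norm \<bar>?a k * ?J k\<bar> \<le> 4 * (d k * (1 / (real (Suc k))\<^sup>2))" for k
      using d(2)[of k] by (auto simp: power2_eq_square abs_mult mult.commute)
  qed
  interpret E: extremal_kernel ?a \<theta> "2 * ((pi + 1) * d 0)" "\<lambda>t. 2 * sin \<theta> * sin_kernel d t" "\<lambda>t. sgn (sin t)" "sin \<theta>" 0
  proof
    show "(\<lambda>t::real. sgn (sin t)) \<in> borel_measurable borel" by (rule sgn_sin_borel)
    show "\<bar>sgn (sin t)\<bar> \<le> 1" for t :: real by (simp add: abs_sgn_eq)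
    show "sgn (sin (t + pi)) = - sgn (sin t)" for t :: real by (simp add: sgn_minus)
    show abs1: "\<bar>sin \<theta>\<bar> = 1" using ss by (metis abs_mult_self_eq abs_1 abs_square_eq_1 power2_eq_square)
    show "(2 * sin \<theta> * sin_kernel d t - 0) * (sin \<theta> * sgn (sin t)) = \<bar>2 * sin \<theta> * sin_kernel d t - 0\<bar>" for t
    proof -
      have "(2 * sin \<theta> * sin_kernel d t - 0) * (sin \<theta> * sgn (sin t)) = 2 * (sin \<theta> * sin \<theta>) * (sin_kernel d t * sgn (sin t))"
        by simp
      then show ?thesis unfolding ss sin_kernel_sign[OF d] by (simp add: abs_mult abs1)
    qed
    have "\<bar>?a k * (sin \<theta> * ?J k)\<bar> = \<bar>?a k * ?J k\<bar>" for k by (simp add: abs_mult abs1)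
    then show "summable (\<lambda>k. \<bar>?a k * (\<integral>t. sgn (sin t) * cos (real (Suc k) * t - \<theta>) \<partial>period_measure)\<bar>)"
      unfolding moments using abs_summable by simp
  qed
  have sm: "summable (\<lambda>k. ?a k * ?J k)" by (rule summable_rabs_cancel[OF abs_summable])
  have even_term: "?a (2 * j) * ?J (2 * j) = 4 * (d (2 * j) / (real (Suc (2 * j)))\<^sup>2)" for j
    by (simp add: power2_eq_square)
  have even: "summable (\<lambda>j. 4 * (d (2 * j) / (real (Suc (2 * j)))\<^sup>2))"
    "(\<Sum>k. ?a k * ?J k) = (\<Sum>j. 4 * (d (2 * j) / (real (Suc (2 * j)))\<^sup>2))"
    using suminf_even_terms[OF sm] unfolding even_term by auto
  show sum: "summable (\<lambda>j. d (2 * j) / (real (Suc (2 * j)))\<^sup>2)"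
    using summable_mult[OF even(1), of "1 / 4"] by simp
  have "2 * pi * E.M = sin \<theta> * (\<Sum>k. 2 * sin \<theta> * (?a k * ?J k))"
    unfolding E.M_eq E.\<sigma>_def moments by (simp only: mult_ac)
  also have "\<dots> = 2 * (sin \<theta> * sin \<theta>) * (\<Sum>k. ?a k * ?J k)"
    by (subst suminf_mult[OF sm]) simp
  also have "\<dots> = 8 * (\<Sum>j. d (2 * j) / (real (Suc (2 * j)))\<^sup>2)"
    unfolding ss even(2) by (subst suminf_mult[OF sum]) simp
  finally have "E.M = 4 / pi * (\<Sum>j. d (2 * j) / (real (Suc (2 * j)))\<^sup>2)" by (simp add: field_simps)
  then show "(SUP f\<in>H1 p. Lp_norm p (conv f (\<lambda>t. 2 * sin \<theta> * sin_kernel d t)))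
      = ereal (4 / pi * (\<Sum>j. d (2 * j) / (real (Suc (2 * j)))\<^sup>2))"
    using E.SUP_Lp_norm_conv_K[OF p] by simp
qed

text \<open>As in the sine case, but with sgn cos and with the value of the kernel at \<pi>/2 as the
  constant c. The alternating signs come from the moments of the square wave and not from the
  kernel.\<close>

lemma extremal_cos:
  assumes d: "decseq d" "\<And>k. 0 \<le> d k" and \<theta>: "sin \<theta> = 0" and p: "p \<in> {1, \<infinity>}"
  shows "summable (\<lambda>j. d (2 * j) / real (Suc (2 * j)) ^ 3 * (-1) ^ j)"
    and "(SUP f\<in>H1 p. Lp_norm p (conv f (\<lambda>t. 2 * cos \<theta> * cos_kernel d t)))
      = ereal (4 / pi * (\<Sum>j. d (2 * j) / real (Suc (2 * j)) ^ 3 * (-1) ^ j))"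
proof -
  let ?a = "\<lambda>k. d k / (real (Suc k))\<^sup>2"
  let ?J = "\<lambda>k. if even k then 4 / real (Suc k) * (-1) ^ (k div 2) else 0 :: real"
  let ?c = "2 * cos \<theta> * cos_kernel d (pi / 2)"
  interpret S: bounded_series ?a \<theta> "2 * (\<Sum>k. d k * (1 / (real (Suc k))\<^sup>2))" "\<lambda>t. 2 * cos \<theta> * cos_kernel d t"
    by (rule bounded_series_cos[OF d \<theta>])
  have cc: "cos \<theta> * cos \<theta> = 1" using sin_cos_squared_add[of \<theta>] \<theta> by (simp add: power2_eq_square)
  have moments: "(\<integral>t. sgn (cos t) * cos (real (Suc k) * t - \<theta>) \<partial>period_measure) = cos \<theta> * ?J k" for k
  proof -
    have *: "sgn (cos t) * cos (real (Suc k) * t - \<theta>) = cos \<theta> * (sgn (cos t) * cos (real (Suc k) * t))" for t :: real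
      unfolding cos_diff \<theta> by simp
    show ?thesis unfolding * integral_sgn_cos[symmetric] by simp
  qed
  have abs_summable: "summable (\<lambda>k. \<bar>?a k * ?J k\<bar>)"
  proof (rule summable_comparison_test'[of _ 0])
    show "summable (\<lambda>k. 4 * (d k * (1 / (real (Suc k))\<^sup>2)))" by (intro summable_mult summable_cos_kernel d)
    show "norm \<bar>?a k * ?J k\<bar> \<le> 4 * (d k * (1 / (real (Suc k))\<^sup>2))" for k
    proof -
      have "\<bar>?J k\<bar> \<le> 4" by (auto simp: abs_mult field_simps)
      have "norm \<bar>?a k * ?J k\<bar> = \<bar>?a k\<bar> * \<bar>?J k\<bar>"
        by (simp only: real_norm_def abs_idempotent abs_mult)
      also have "\<dots> \<le> \<bar>?a k\<bar> * 4" using \<open>\<bar>?J k\<bar> \<le> 4\<close> by (rule mult_left_mono) simp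
      also have "\<dots> = 4 * (d k * (1 / (real (Suc k))\<^sup>2))" using d(2)[of k] by simp
      finally show ?thesis .
    qed
  qed
  interpret E: extremal_kernel ?a \<theta> "2 * (\<Sum>k. d k * (1 / (real (Suc k))\<^sup>2))" "\<lambda>t. 2 * cos \<theta> * cos_kernel d t"
    "\<lambda>t. sgn (cos t)" "cos \<theta>" ?c
  proof
    show "(\<lambda>t::real. sgn (cos t)) \<in> borel_measurable borel" by (rule sgn_cos_borel)
    show "\<bar>sgn (cos t)\<bar> \<le> 1" for t :: real by (simp add: abs_sgn_eq)
    show "sgn (cos (t + pi)) = - sgn (cos t)" for t :: real by (simp add: sgn_minus)
    show abs1: "\<bar>cos \<theta>\<bar> = 1" using cc by (metis abs_mult_self_eq abs_1 abs_square_eq_1 power2_eq_square)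
    show "(2 * cos \<theta> * cos_kernel d t - ?c) * (cos \<theta> * sgn (cos t)) = \<bar>2 * cos \<theta> * cos_kernel d t - ?c\<bar>" for t
    proof -
      have "(2 * cos \<theta> * cos_kernel d t - ?c) * (cos \<theta> * sgn (cos t))
          = 2 * (cos \<theta> * cos \<theta>) * ((cos_kernel d t - cos_kernel d (pi / 2)) * sgn (cos t))"
        by (simp add: algebra_simps)
      also have "\<dots> = 2 * \<bar>cos_kernel d t - cos_kernel d (pi / 2)\<bar>"
        unfolding cc cos_kernel_sign[OF d] by simp
      also have "\<dots> = \<bar>2 * cos \<theta> * (cos_kernel d t - cos_kernel d (pi / 2))\<bar>" by (simp add: abs_mult abs1)
      finally show ?thesis by (simp add: right_diff_distrib)
    qed
    have "\<bar>?a k * (cos \<theta> * ?J k)\<bar> = \<bar>?a k * ?J k\<bar>" for k by (simp add: abs_mult abs1)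
    then show "summable (\<lambda>k. \<bar>?a k * (\<integral>t. sgn (cos t) * cos (real (Suc k) * t - \<theta>) \<partial>period_measure)\<bar>)"
      unfolding moments using abs_summable by simp
  qed
  have sm: "summable (\<lambda>k. ?a k * ?J k)" by (rule summable_rabs_cancel[OF abs_summable])
  have even_term: "?a (2 * j) * ?J (2 * j) = 4 * (d (2 * j) / real (Suc (2 * j)) ^ 3 * (-1) ^ j)" for j
    by (simp add: power2_eq_square power3_eq_cube)
  have even: "summable (\<lambda>j. 4 * (d (2 * j) / real (Suc (2 * j)) ^ 3 * (-1) ^ j))"
    "(\<Sum>k. ?a k * ?J k) = (\<Sum>j. 4 * (d (2 * j) / real (Suc (2 * j)) ^ 3 * (-1) ^ j))"
    using suminf_even_terms[OF sm] unfolding even_term by auto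
  show sum: "summable (\<lambda>j. d (2 * j) / real (Suc (2 * j)) ^ 3 * (-1) ^ j)"
    using summable_mult[OF even(1), of "1 / 4"] by simp
  have "2 * pi * E.M = cos \<theta> * (\<Sum>k. 2 * cos \<theta> * (?a k * ?J k))"
    unfolding E.M_eq E.\<sigma>_def moments by (simp only: mult_ac)
  also have "\<dots> = 2 * (cos \<theta> * cos \<theta>) * (\<Sum>k. ?a k * ?J k)"
    by (subst suminf_mult[OF sm]) simp
  also have "\<dots> = 8 * (\<Sum>j. d (2 * j) / real (Suc (2 * j)) ^ 3 * (-1) ^ j)"
    unfolding cc even(2) by (subst suminf_mult[OF sum]) simp
  finally have "E.M = 4 / pi * (\<Sum>j. d (2 * j) / real (Suc (2 * j)) ^ 3 * (-1) ^ j)" by (simp add: field_simps)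
  then show "(SUP f\<in>H1 p. Lp_norm p (conv f (\<lambda>t. 2 * cos \<theta> * cos_kernel d t)))
      = ereal (4 / pi * (\<Sum>j. d (2 * j) / real (Suc (2 * j)) ^ 3 * (-1) ^ j))"
    using E.SUP_Lp_norm_conv_K[OF p] by simp
qed

subsection \<open>The exponent \<open>m(h)\<close> and the theorem\<close>

text \<open>Since the Cesaro means of the moments tend to zero, the Riemann-Lebesgue lemma is not needed.\<close>

lemma cos_moment_not_bounded_below:
  assumes g: "integrable period_measure g" and c: "0 < c"
  shows "\<not> (\<forall>k\<ge>N. c \<le> cos_moment g (Suc k))"
proof
  assume ge: "\<forall>k\<ge>N. c \<le> cos_moment g (Suc k)"
  \<comment> \<open>The average of the first n cosines is bounded by 1 and tends to 0 at every point
    of the period other than t = 0.\<close>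
  let ?A = "\<lambda>n t. (\<Sum>k<n. cos (real (Suc k) * t)) / real n"
  have A_borel: "?A n \<in> borel_measurable borel" for n
    by (intro borel_measurable_divide borel_measurable_sum borel_measurable_harmonic) simp
  have A_bound: "\<bar>?A n t\<bar> \<le> 1" for n t
  proof -
    have "\<bar>\<Sum>k<n. cos (real (Suc k) * t)\<bar> \<le> (\<Sum>k<n. 1)"
      by (rule sum_abs[THEN order_trans]) (intro sum_mono abs_cos_le_one)
    then show ?thesis by (cases "n = 0") (simp_all add: abs_divide field_simps del: of_nat_Suc)
  qed
  have gA: "integrable period_measure (\<lambda>t. g t * ?A n t)" for n
    by (rule integrable_mult_bounded[OF g borel_imp_lebesgue_measurable[OF A_borel] A_bound])
  have "(\<lambda>n. \<integral>t. g t * ?A n t \<partial>period_measure) \<longlonglongrightarrow> (\<integral>t. 0 \<partial>period_measure)"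
  proof (rule integral_dominated_convergence[where w = "\<lambda>t. \<bar>g t\<bar>"])
    have "AE t in period_measure. t \<noteq> 0"
      using AE_lebesgue_neq[of 0] by (subst AE_restrict_space_iff) auto
    moreover have "AE t in period_measure. t \<in> {-pi..pi}"
      using AE_space[of period_measure] by (simp add: space_restrict_space)
    ultimately show "AE t in period_measure. (\<lambda>n. g t * ?A n t) \<longlonglongrightarrow> 0"
    proof eventually_elim
      case (elim t)
      have "sin (t / 2) \<noteq> 0"
      proof (cases "0 < t")
        case True
        then show ?thesis using elim sin_gt_zero[of "t / 2"] by auto
      next
        case False
        then show ?thesis using elim sin_gt_zero[of "- t / 2"] by auto
      qed
      then have B: "\<bar>\<Sum>k<n. cos (real (Suc k) * t)\<bar> \<le> 1 / \<bar>sin (t / 2)\<bar>" for n by (rule sum_cos_bounded)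
      have "(\<lambda>n. ?A n t) \<longlonglongrightarrow> 0"
      proof (rule Lim_null_comparison)
        show "eventually (\<lambda>n. norm (?A n t) \<le> 1 / \<bar>sin (t / 2)\<bar> / real n) sequentially"
        proof (intro always_eventually allI)
          fix n
          show "norm (?A n t) \<le> 1 / \<bar>sin (t / 2)\<bar> / real n"
            using divide_right_mono[OF B, of "real n" n] by (simp only: real_norm_def abs_divide abs_of_nat of_nat_0_le_iff)
        qed
        show "(\<lambda>n. 1 / \<bar>sin (t / 2)\<bar> / real n) \<longlonglongrightarrow> 0" by (rule lim_const_over_n)
      qed
      then show ?case by (rule tendsto_mult_right_zero)
    qed
    show "\<And>n. AE t in period_measure. norm (g t * ?A n t) \<le> \<bar>g t\<bar>"
      using mult_left_mono[OF A_bound, of "\<bar>g _\<bar>"] by (simp add: abs_mult)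
  qed (use g gA in auto)
  then have lim0: "(\<lambda>n. \<integral>t. g t * ?A n t \<partial>period_measure) \<longlonglongrightarrow> 0" by simp
  have mean: "(\<integral>t. g t * ?A n t \<partial>period_measure) = (\<Sum>k<n. cos_moment g (Suc k)) / real n" for n
  proof -
    have *: "g t * ?A n t = (\<Sum>k<n. g t * cos (real (Suc k) * t)) / real n" for t
      by (simp add: sum_distrib_left)
    show ?thesis unfolding * cos_moment_def using integrable_mult_harmonic(3)[OF g]
      by (simp add: Bochner_Integration.integral_sum del: of_nat_Suc)
  qed
  note lim = lim0[unfolded mean]
  \<comment> \<open>Absorbs the first N moments, about which nothing is assumed; divided by n it
    disappears in the limit.\<close>
  define B where "B = (\<Sum>k<N. \<bar>cos_moment g (Suc k) - c\<bar>)"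
  have ge': "c - B / real n \<le> (\<Sum>k<n. cos_moment g (Suc k)) / real n" if "N < n" for n
  proof -
    have "(\<Sum>k<n. cos_moment g (Suc k) - c) = (\<Sum>k<N. cos_moment g (Suc k) - c) + (\<Sum>k=N..<n. cos_moment g (Suc k) - c)"
      using that by (metis lessThan_atLeast0 less_imp_le_nat sum.atLeastLessThan_concat zero_le)
    moreover have "0 \<le> (\<Sum>k=N..<n. cos_moment g (Suc k) - c)" using ge by (intro sum_nonneg) simp
    moreover have "- B \<le> (\<Sum>k<N. cos_moment g (Suc k) - c)"
      unfolding B_def sum_negf[symmetric] by (intro sum_mono) linarith
    ultimately have "real n * c - B \<le> (\<Sum>k<n. cos_moment g (Suc k))" by (simp add: sum_subtractf)
    then have "(real n * c - B) / real n \<le> (\<Sum>k<n. cos_moment g (Suc k)) / real n"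
      by (rule divide_right_mono) simp
    then show ?thesis using that by (simp add: diff_divide_distrib)
  qed
  have "c - 0 \<le> 0"
  proof (rule LIMSEQ_le[OF tendsto_diff[OF tendsto_const lim_const_over_n] lim])
    show "\<exists>N. \<forall>n\<ge>N. c - B / real n \<le> (\<Sum>k<n. cos_moment g (Suc k)) / real n"
      using ge' by (intro exI[of _ "Suc N"]) auto
  qed
  then show False using c by simp
qed

text \<open>The coefficient is the cosine moment minus \<i> times the sine moment, over 2 \<pi>; a
  real value leaves no imaginary part.\<close>

lemma moments_of_fourier_coeff:
  assumes g: "integrable period_measure g" and c: "fourier_coeff g (int k) = complex_of_real u"
  shows "cos_moment g k = 2 * pi * u" "sin_moment g k = 0"
proof -
  have lin: "(\<integral>t. complex_of_real (u t) - \<i> * of_real (v t) \<partial>period_measure)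
      = of_real (\<integral>t. u t \<partial>period_measure) - \<i> * of_real (\<integral>t. v t \<partial>period_measure)"
    if "integrable period_measure u" "integrable period_measure v" for u v
    using that by (subst Bochner_Integration.integral_diff) (auto simp: integrable_of_real)
  have integrand: "complex_of_real (g t) * exp (- \<i> * of_int (int k) * of_real t)
      = of_real (g t * cos (real k * t)) - \<i> * of_real (g t * sin (real k * t))" for t
  proof -
    have "exp (- \<i> * of_int (int k) * of_real t) = cis (- (real k * t))" unfolding cis_conv_exp by (simp add: mult.assoc)
    then show ?thesis by (simp only:) (simp add: complex_eq_iff)
  qed
  have "fourier_coeff g (int k) = 1 / (2 * pi) * (of_real (cos_moment g k) - \<i> * of_real (sin_moment g k))"
    unfolding fourier_coeff_def cos_moment_def sin_moment_def integrand lin[OF integrable_mult_harmonic(3,4)[OF g]] ..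
  then have eq: "complex_of_real (cos_moment g k) - \<i> * of_real (sin_moment g k) = of_real (2 * pi * u)"
    using c by (simp add: field_simps)
  show "cos_moment g k = 2 * pi * u" using arg_cong[OF eq, of Re] by simp
  show "sin_moment g k = 0" using arg_cong[OF eq, of Im] by simp
qed

section \<open>Admissible exponents and the sampling points\<close>

definition admissible_exponents :: "(real \<Rightarrow> real) \<Rightarrow> real set" where
  "admissible_exponents h = {\<gamma>. antimono_on {0<..} (\<lambda>x. (1 - h x) / x powr \<gamma>)}"

lemma m_index_alt: "m_index h = (INF \<gamma>\<in>admissible_exponents h. ereal \<gamma>)"
  unfolding m_index_def admissible_exponents_def ..

lemma admissible_exponentsD:
  "\<gamma> \<in> admissible_exponents h \<Longrightarrow> 0 < x \<Longrightarrow> x \<le> y \<Longrightarrow> (1 - h y) / y powr \<gamma> \<le> (1 - h x) / x powr \<gamma>"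
  unfolding admissible_exponents_def by (auto simp: monotone_on_def)

text \<open>A larger exponent contributes one more decreasing power as a factor. Products of
  decreasing functions decrease here because 1 - h is nonnegative.\<close>

lemma admissible_exponents_upward:
  assumes h: "\<And>x. 0 < x \<Longrightarrow> h x \<le> 1" and \<gamma>: "\<gamma> \<in> admissible_exponents h" "\<gamma> \<le> \<gamma>'"
  shows "\<gamma>' \<in> admissible_exponents h"
  unfolding admissible_exponents_def mem_Collect_eq
proof (rule monotone_onI)
  fix x y :: real assume xy: "x \<in> {0<..}" "y \<in> {0<..}" "x \<le> y"
  have split: "(1 - h z) / z powr \<gamma>' = (1 - h z) / z powr \<gamma> * z powr (\<gamma> - \<gamma>')" if "0 < z" for z
    using that by (simp add: powr_diff)
  have "(1 - h y) / y powr \<gamma> * y powr (\<gamma> - \<gamma>') \<le> (1 - h x) / x powr \<gamma> * x powr (\<gamma> - \<gamma>')"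
    using xy h[of x] \<gamma>(2) by (intro mult_mono admissible_exponentsD[OF \<gamma>(1)] powr_mono2') auto
  then show "(1 - h x) / x powr \<gamma>' \<ge> (1 - h y) / y powr \<gamma>'" using xy by (simp add: split)
qed

text \<open>Exponents m + 1/n are admissible, and for two fixed points the weak inequality survives
  n tending to infinity. This is what admits equality in the thresholds on r.\<close>

lemma m_index_attained:
  assumes h: "\<And>x. 0 < x \<Longrightarrow> h x \<le> 1" and m: "m_index h = ereal m"
  shows "m \<in> admissible_exponents h"
proof -
  have above: "\<gamma> \<in> admissible_exponents h" if "m < \<gamma>" for \<gamma>
  proof -
    have "m_index h < ereal \<gamma>" using that m by simp
    then obtain \<gamma>' where "\<gamma>' \<in> admissible_exponents h" "\<gamma>' < \<gamma>"
      unfolding m_index_alt by (auto simp: INF_less_iff)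
    then show ?thesis using admissible_exponents_upward[where h = h and \<gamma> = \<gamma>' and \<gamma>' = \<gamma>, OF h] by simp
  qed
  show ?thesis unfolding admissible_exponents_def mem_Collect_eq
  proof (rule monotone_onI)
    fix x y :: real assume xy: "x \<in> {0<..}" "y \<in> {0<..}" "x \<le> y"
    have lim: "(\<lambda>n. (1 - h z) / z powr (m + 1 / real (Suc n))) \<longlonglongrightarrow> (1 - h z) / z powr (m + 0)" if "0 < z" for z
      using that
      by (intro tendsto_divide tendsto_const tendsto_powr tendsto_add
          LIMSEQ_inverse_real_of_nat[unfolded inverse_eq_divide]) simp_all
    have "(1 - h y) / y powr (m + 1 / real (Suc n)) \<le> (1 - h x) / x powr (m + 1 / real (Suc n))" for n
      using xy by (intro admissible_exponentsD above) auto
    then show "(1 - h x) / x powr m \<ge> (1 - h y) / y powr m"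
      using LIMSEQ_le[OF lim[of y] lim[of x]] xy by simp
  qed
qed

lemma ex_index_ge:
  assumes "0 < \<alpha>" "0 < \<delta>"
  obtains N where "\<And>k. N \<le> k \<Longrightarrow> X \<le> real (Suc k) powr \<alpha> * \<delta>"
proof -
  \<comment> \<open>The maximum with 1 keeps Y positive, so that raising to 1/\<alpha> and then to
    \<alpha> returns Y.\<close>
  define Y where "Y = max X 1 / \<delta>"
  have Y: "0 < Y" unfolding Y_def using assms by simp
  obtain N :: nat where N: "Y powr (1 / \<alpha>) \<le> real N" using real_arch_simple by blast
  show ?thesis
  proof (rule that)
    fix k assume "N \<le> k"
    then have "(Y powr (1 / \<alpha>)) powr \<alpha> \<le> real (Suc k) powr \<alpha>" using N assms by (intro powr_mono2) auto
    then have "Y \<le> real (Suc k) powr \<alpha>" using Y assms by (simp add: powr_powr)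
    then have "Y * \<delta> \<le> real (Suc k) powr \<alpha> * \<delta>" using assms by (intro mult_right_mono) auto
    then show "X \<le> real (Suc k) powr \<alpha> * \<delta>" unfolding Y_def using assms by simp
  qed
qed

text \<open>As \<open>psi\<close> is a pointwise \<open>suminf\<close>, convergence at every t,
  multiples of 2\<pi> included, makes it the limit function everywhere.\<close>

lemma psi_eq:
  assumes "bounded_series (\<lambda>k. 1 / real (Suc k) powr r) (\<beta> * pi / 2) C \<Psi>"
  shows "psi r \<beta> = \<Psi>"
proof
  fix t
  have "(\<lambda>k. 2 * cos (real (Suc k) * t - \<beta> * pi / 2) / real (Suc k) powr r) sums \<Psi> t"
    using bounded_series.trig_sum_tendsto[OF assms, of t] unfolding trig_sum_def sums_def by simp
  then show "psi r \<beta> t = \<Psi> t" unfolding psi_def by (simp add: sums_iff)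
qed

lemma approx_error_eq:
  assumes B: "bounded_series (\<lambda>k. 1 / real (Suc k) powr r) (\<beta> * pi / 2) C\<^sub>1 \<Psi>"
    and A: "bounded_series (\<lambda>k. (1 - h k) / real (Suc k) powr r) (\<beta> * pi / 2) C\<^sub>2 K"
    and g: "integrable period_measure g" "\<And>k. cos_moment g (Suc k) = 2 * pi * h k" "\<And>k. sin_moment g (Suc k) = 0"
    and p: "p \<in> {1, \<infinity>}"
  shows "approx_error (W_class r \<beta> p) (\<lambda>f. conv f g) p = (SUP f\<in>H1 p. Lp_norm p (conv f K))"
proof -
  have "W_class r \<beta> p = (\<lambda>\<phi>. conv \<phi> \<Psi>) ` H1 p"
    unfolding W_class_def psi_eq[OF B] by blast
  then have "approx_error (W_class r \<beta> p) (\<lambda>f. conv f g) p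
      = (SUP \<phi>\<in>H1 p. Lp_norm p (\<lambda>x. conv \<phi> \<Psi> x - conv (conv \<phi> \<Psi>) g x))"
    unfolding approx_error_def by (simp add: image_image)
  also have "\<dots> = (SUP f\<in>H1 p. Lp_norm p (conv f K))"
  proof (intro SUP_cong refl)
    fix \<phi> assume "\<phi> \<in> H1 p"
    then have "periodic_L1 \<phi>" using H1_D(1)[OF _ p] by blast
    then have "conv \<phi> \<Psi> x - conv (conv \<phi> \<Psi>) g x = conv \<phi> K x" for x
      by (intro conv_multiplier_error[OF B A _ _ g]) simp_all
    then show "Lp_norm p (\<lambda>x. conv \<phi> \<Psi> x - conv (conv \<phi> \<Psi>) g x) = Lp_norm p (conv \<phi> K)" by simp
  qed
  finally show ?thesis .
qed

theorem mainTheorem3: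
  fixes h g :: "real \<Rightarrow> real" and \<alpha> \<delta> :: real
  assumes "\<forall>x>0. h x \<le> 1" and "m_index h < \<infinity>"
    and "\<alpha> > 0" and "\<delta> > 0"
    and "g \<in> Lp 1"
    and "\<forall>k::int. fourier_coeff g k = complex_of_real (h (real_of_int \<bar>k\<bar> powr \<alpha> * \<delta>))"
  shows "m_index h \<ge> 0 \<and>
    ((\<exists>x0>0. h x0 > 0) \<longrightarrow> m_index h > 0) \<and>
    (\<forall>p\<in>{1, \<infinity>}.
      (\<forall>(\<beta>::int) (r::real). odd \<beta> \<and> ereal r \<ge> ereal \<alpha> * m_index h + 1 \<longrightarrow>
        summable (\<lambda>k::nat. (1 - h (real (2 * k + 1) powr \<alpha> * \<delta>)) / real (2 * k + 1) powr (r + 1)) \<and>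
        approx_error (W_class r (real_of_int \<beta>) p) (\<lambda>f. conv f g) p =
          ereal (4 / pi * (\<Sum>k::nat. (1 - h (real (2 * k + 1) powr \<alpha> * \<delta>)) / real (2 * k + 1) powr (r + 1)))) \<and>
      (\<forall>(\<beta>::int) (r::real). even \<beta> \<and> ereal r \<ge> ereal \<alpha> * m_index h + 2 \<longrightarrow>
        summable (\<lambda>k::nat. (1 - h (real (2 * k + 1) powr \<alpha> * \<delta>)) / real (2 * k + 1) powr (r + 1) * (-1) ^ k) \<and>
        approx_error (W_class r (real_of_int \<beta>) p) (\<lambda>f. conv f g) p =
          ereal (4 / pi * (\<Sum>k::nat. (1 - h (real (2 * k + 1) powr \<alpha> * \<delta>)) / real (2 * k + 1) powr (r + 1) * (-1) ^ k))))"
proof -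
  define x where "x k = real (Suc k) powr \<alpha> * \<delta>" for k
  have x_pos: "0 < x k" for k unfolding x_def using assms(4) by simp
  have h_le: "h y \<le> 1" if "0 < y" for y using assms(1) that by blast
  have gi: "integrable period_measure g"
    using assms(5) Lp_norm_1(2) unfolding Lp_def by blast
  have "fourier_coeff g (int (Suc k)) = complex_of_real (h (x k))" for k
    using assms(6)[rule_format, of "int (Suc k)"] unfolding x_def by simp
  note moments = moments_of_fourier_coeff[OF gi this]
  have h_small: "\<not> (\<forall>k\<ge>N. c \<le> h (x k))" if "0 < c" for N c
    using cos_moment_not_bounded_below[OF gi, of "2 * pi * c" N] that unfolding moments by simp
  \<comment> \<open>A negative exponent would force 1 - h to 0 at infinity, hence h \<ge> 1/2 at all
    late sampling points, against the vanishing means of the cosine moments of g.\<close>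
  have exp_nonneg: "0 \<le> \<gamma>" if \<gamma>: "\<gamma> \<in> admissible_exponents h" for \<gamma>
  proof (rule ccontr)
    assume "\<not> 0 \<le> \<gamma>"
    then have "((\<lambda>y. (1 - h 1) * y powr \<gamma>) \<longlongrightarrow> (1 - h 1) * 0) at_top"
      by (intro tendsto_mult tendsto_const tendsto_neg_powr filterlim_ident) auto
    then have "eventually (\<lambda>y. (1 - h 1) * y powr \<gamma> < 1 / 2) at_top"
      by (rule order_tendstoD) simp
    then obtain X where X: "\<And>y. X \<le> y \<Longrightarrow> (1 - h 1) * y powr \<gamma> < 1 / 2"
      by (auto simp: eventually_at_top_linorder)
    obtain N where N: "\<And>k. N \<le> k \<Longrightarrow> max X 1 \<le> x k"
      unfolding x_def by (rule ex_index_ge[OF assms(3,4), of "max X 1"]) blast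
    have "1 / 2 \<le> h (x k)" if "N \<le> k" for k
    proof -
      have "(1 - h (x k)) / x k powr \<gamma> \<le> (1 - h 1) / 1 powr \<gamma>"
        using N[OF that] by (intro admissible_exponentsD[OF \<gamma>]) auto
      then have "1 - h (x k) \<le> (1 - h 1) * x k powr \<gamma>" using x_pos[of k] by (simp add: pos_divide_le_eq)
      then show ?thesis using X[of "x k"] N[OF that] by simp
    qed
    then show False using h_small[of "1 / 2" N] by simp
  qed
  have m_nonneg: "0 \<le> m_index h" unfolding m_index_alt using exp_nonneg by (auto intro!: INF_greatest)
  then obtain m where m: "m_index h = ereal m" "0 \<le> m" using assms(2) by (cases "m_index h") auto
  note m_adm = m_index_attained[OF h_le m(1)]
  \<comment> \<open>If m = 0, then 1 - h itself decreases, so h stays above h(x0) > 0 at all late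
    sampling points, and the same contradiction arises.\<close>
  have m_pos: "m_index h > 0" if pos: "\<exists>x0>0. h x0 > 0"
  proof (rule ccontr)
    assume "\<not> m_index h > 0"
    then have "m = 0" using m by simp
    obtain x0 where x0: "0 < x0" "0 < h x0" using pos by blast
    obtain N where N: "\<And>k. N \<le> k \<Longrightarrow> x0 \<le> x k"
      unfolding x_def by (rule ex_index_ge[OF assms(3,4), of x0]) blast
    have "h x0 \<le> h (x k)" if "N \<le> k" for k
      using admissible_exponentsD[OF m_adm x0(1) N[OF that]] x0(1) x_pos[of k] \<open>m = 0\<close> by simp
    then show False using h_small[OF x0(2)] by blast
  qed
  \<comment> \<open>The coefficient of frequency k + 1 times (k + 1)^\<rho>: \<rho> = 1 feeds the
    sine kernel, \<rho> = 2 the cosine kernel.\<close>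
  define d where "d \<rho> r k = (1 - h (x k)) * real (Suc k) powr (\<rho> - r)" for \<rho> r k
  have d_nonneg: "0 \<le> d \<rho> r k" for \<rho> r k unfolding d_def using h_le[OF x_pos, of k] by simp
  have d_mono: "decseq (d \<rho> r)" if "\<alpha> * m + \<rho> \<le> r" for \<rho> r
  proof (rule decseq_SucI)
    fix k
    \<comment> \<open>The first factor is the function that decreases by admissibility of m, sampled
      at \<open>x k\<close>; the power of \<delta> compensates the one contained in
      \<open>x k powr m\<close>.\<close>
    have split: "d \<rho> r k = (1 - h (x k)) / x k powr m * (\<delta> powr m * real (Suc k) powr (\<alpha> * m + \<rho> - r))" for k
    proof -
      have "x k powr m = real (Suc k) powr (\<alpha> * m) * \<delta> powr m"
        unfolding x_def using assms(4) by (simp add: powr_mult powr_powr)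
      moreover have "real (Suc k) powr (\<alpha> * m + \<rho> - r) = real (Suc k) powr (\<alpha> * m) * real (Suc k) powr (\<rho> - r)"
        by (simp add: powr_add[symmetric] algebra_simps del: of_nat_Suc)
      ultimately show ?thesis unfolding d_def using assms(4) by (simp del: of_nat_Suc)
    qed
    have "x k \<le> x (Suc k)" unfolding x_def using assms(3,4) by (intro mult_right_mono powr_mono2) auto
    then have "(1 - h (x (Suc k))) / x (Suc k) powr m \<le> (1 - h (x k)) / x k powr m"
      using x_pos[of k] by (intro admissible_exponentsD[OF m_adm])
    moreover have "real (Suc (Suc k)) powr (\<alpha> * m + \<rho> - r) \<le> real (Suc k) powr (\<alpha> * m + \<rho> - r)"
      using that by (intro powr_mono2') auto
    ultimately show "d \<rho> r (Suc k) \<le> d \<rho> r k"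
      unfolding split using h_le[OF x_pos, of k] by (intro mult_mono mult_left_mono) auto
  qed
  define b where "b \<rho> r k = real (Suc k) powr (\<rho> - r)" for \<rho> r :: real and k
  have b_nonneg: "0 \<le> b \<rho> r k" for \<rho> r k unfolding b_def by simp
  have b_mono: "decseq (b \<rho> r)" if "\<alpha> * m + \<rho> \<le> r" for \<rho> r
  proof (rule decseq_SucI)
    \<comment> \<open>Nonnegativity of m turns the threshold into r \<ge> \<rho>, as the
      coefficients of \<psi> demand.\<close>
    have "0 \<le> \<alpha> * m" using assms(3) m(2) by simp
    then show "b \<rho> r (Suc k) \<le> b \<rho> r k" for k
      unfolding b_def using that by (intro powr_mono2') auto
  qed
  \<comment> \<open>The first two equations restore the kernel coefficients. The last two include
    the extra 1/(k + 1) from the moment of the square wave, which is why the answer has exponent r +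
    1.\<close>
  have powr_split: "real (Suc k) powr (1 - r) / real (Suc k) = 1 / real (Suc k) powr r"
    "real (Suc k) powr (2 - r) / (real (Suc k))\<^sup>2 = 1 / real (Suc k) powr r"
    "real (Suc k) powr (1 - r) / (real (Suc k))\<^sup>2 = 1 / real (Suc k) powr (r + 1)"
    "real (Suc k) powr (2 - r) / real (Suc k) ^ 3 = 1 / real (Suc k) powr (r + 1)" for k r
    by (simp_all add: powr_diff powr_add power2_eq_square power3_eq_cube field_simps del: of_nat_Suc)
  have d_split: "d 1 r k / real (Suc k) = (1 - h (x k)) / real (Suc k) powr r"
    "d 2 r k / (real (Suc k))\<^sup>2 = (1 - h (x k)) / real (Suc k) powr r"
    "d 1 r k / (real (Suc k))\<^sup>2 = (1 - h (x k)) / real (Suc k) powr (r + 1)"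
    "d 2 r k / real (Suc k) ^ 3 = (1 - h (x k)) / real (Suc k) powr (r + 1)" for k r
    unfolding d_def times_divide_eq_right[symmetric] powr_split by simp_all
  have coeff: "(1 - h (real (2 * k + 1) powr \<alpha> * \<delta>)) / real (2 * k + 1) powr (r + 1)
      = (1 - h (x (2 * k))) / real (Suc (2 * k)) powr (r + 1)" for k r
    unfolding x_def by simp
  have odd_case: "summable (\<lambda>k. (1 - h (real (2 * k + 1) powr \<alpha> * \<delta>)) / real (2 * k + 1) powr (r + 1)) \<and>
        approx_error (W_class r (real_of_int \<beta>) p) (\<lambda>f. conv f g) p =
          ereal (4 / pi * (\<Sum>k. (1 - h (real (2 * k + 1) powr \<alpha> * \<delta>)) / real (2 * k + 1) powr (r + 1)))"
    if p: "p \<in> {1, \<infinity>}" and \<beta>: "odd \<beta>" and r: "ereal r \<ge> ereal \<alpha> * m_index h + 1" for p r and \<beta> :: int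
  proof -
    have r': "\<alpha> * m + 1 \<le> r" using r unfolding m(1) by (simp add: one_ereal_def)
    have "cos (real_of_int \<beta> * pi / 2) = 0" using \<beta> cos_zero_iff_int by (simp add: mult.commute[of _ "pi / 2"])
    note \<theta> = this
    note A = bounded_series_sin[OF d_mono[OF r'] d_nonneg \<theta>, unfolded d_split]
    note B = bounded_series_sin[OF b_mono[OF r'] b_nonneg \<theta>, unfolded b_def powr_split]
    show ?thesis
      unfolding coeff approx_error_eq[OF B A gi moments p] d_split(3)[symmetric]
      using extremal_sin[OF d_mono[OF r'] d_nonneg \<theta> p] by blast
  qed
  have even_case: "summable (\<lambda>k. (1 - h (real (2 * k + 1) powr \<alpha> * \<delta>)) / real (2 * k + 1) powr (r + 1) * (-1) ^ k) \<and>
        approx_error (W_class r (real_of_int \<beta>) p) (\<lambda>f. conv f g) p =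
          ereal (4 / pi * (\<Sum>k. (1 - h (real (2 * k + 1) powr \<alpha> * \<delta>)) / real (2 * k + 1) powr (r + 1) * (-1) ^ k))"
    if p: "p \<in> {1, \<infinity>}" and \<beta>: "even \<beta>" and r: "ereal r \<ge> ereal \<alpha> * m_index h + 2" for p r and \<beta> :: int
  proof -
    have "(2::ereal) = ereal 2" by simp
    then have r': "\<alpha> * m + 2 \<le> r" using r unfolding m(1) by simp
    have "sin (real_of_int \<beta> * pi / 2) = 0" using \<beta> sin_zero_iff_int by (simp add: mult.commute[of _ "pi / 2"])
    note \<theta> = this
    note A = bounded_series_cos[OF d_mono[OF r'] d_nonneg \<theta>, unfolded d_split]
    note B = bounded_series_cos[OF b_mono[OF r'] b_nonneg \<theta>, unfolded b_def powr_split]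
    show ?thesis
      unfolding coeff approx_error_eq[OF B A gi moments p] d_split(4)[symmetric]
      using extremal_cos[OF d_mono[OF r'] d_nonneg \<theta> p] by blast
  qed
  show ?thesis
    by (rule conjI[OF m_nonneg], rule conjI[OF impI[OF m_pos]], assumption, rule ballI, rule conjI;
        intro allI impI; elim conjE; rule odd_case even_case; assumption)
qed

end
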